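(* Let $\omega$ be a radial weight on $\mathbb{C}$. Assume that $\varphi,g\in\mathcal{H}ol(\mathbb{C})$, $\alpha>0$ and $0<q\le\infty$. Then the following properties are equivalent: (i) $C_{\varphi,g}:\mathcal{A}^\omega(\mathbb{C})\to\mathcal{F}_\alpha^q(\mathbb{C})$ is a bounded operator; (ii) $$\frac{|g'(\varphi(z))\,\varphi'(z)|}{1+|z|}\,e^{-\frac{\alpha}{2}|z|^2}\,\widetilde{\omega}(|\varphi(z)|)\in L^q(\mathbb{C},\nu_1).$$
   Context: $\mathcal{H}ol(\mathbb{C})$ is the space of entire functions on $\mathbb{C}$ and $\nu_1$ is Lebesgue (area) measure on $\mathbb{C}$. A weight function is a non-decreasing, continuous, unbounded function $\omega:[0,+\infty)\to(0,+\infty)$; it is always assumed in addition that $\lim_{t\to+\infty}t^{-k}\omega(t)=\infty$ for all $k\in\mathbb{N}$. A radial weight on $\mathbb{C}$ is the extension $\omega(z)=\omega(|z|)$, $z\in\mathbb{C}$, of a weight function. The growth space $\mathcal{A}^\omega(\mathbb{C})$ consists of those $f\in\mathcal{H}ol(\mathbb{C})$ with $\|f\|_{\mathcal{A}^\omega}=\sup_{z\in\mathbb{C}}|f(z)|/\omega(z)<\infty$. The associated weight function $\widetilde{\omega}:[0,+\infty)\to(0,+\infty)$ is defined by $\widetilde{\omega}(|z|)=\sup\{|f(z)|: f\in\mathcal{H}ol(\mathbb{C}),\ |f(w)|\le\omega(|w|)\text{ for all }w\in\mathbb{C}\}$, $z\in\mathbb{C}$ (the supremum depends only on $|z|$). For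 $0<q<\infty$, the Fock space $\mathcal{F}_\alpha^q(\mathbb{C})$ consists of those $f\in\mathcal{H}ol(\mathbb{C})$ with $\|f\|_{\mathcal{F}_\alpha^q}^q=\frac{\alpha q}{2\pi}\int_{\mathbb{C}}|f(z)|^q e^{-\frac{\alpha q}{2}|z|^2}\,d\nu_1(z)<\infty$; $\mathcal{F}_\alpha^\infty(\mathbb{C})$ consists of those $f\in\mathcal{H}ol(\mathbb{C})$ with $\|f\|_{\mathcal{F}_\alpha^\infty}=\sup_{z\in\mathbb{C}}|f(z)|e^{-\frac{\alpha}{2}|z|^2}<\infty$. The operator $C_{\varphi,g}=C_\varphi\circ V_g$, where $C_\varphi f=f\circ\varphi$ and $V_gf(z)=\int_0^z f(\xi)g'(\xi)\,d\xi$; that is, $C_{\varphi,g}f(z)=\int_0^{\varphi(z)}f(\xi)g'(\xi)\,d\xi$, $f\in\mathcal{H}ol(\mathbb{C})$, $z\in\mathbb{C}$. *)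

theory Defs
  imports "HOL-Complex_Analysis.Complex_Analysis"
begin

text \<open>Weights live on \<open>[0, \<infinity>)\<close>, so only their values at nonnegative arguments are
  constrained; the radial weight on the complex plane is \<open>\<lambda>z. \<omega> (cmod z)\<close>.\<close>

definition weight_function :: "(real \<Rightarrow> real) \<Rightarrow> bool" where
  "weight_function \<omega> \<longleftrightarrow>
     (\<forall>t\<ge>0. 0 < \<omega> t) \<and>
     mono_on {0..} \<omega> \<and>
     continuous_on {0..} \<omega> \<and>
     \<not> bdd_above (\<omega> ` {0..}) \<and>
     (\<forall>k::nat. filterlim (\<lambda>t. \<omega> t / t ^ k) at_top at_top)"

definition growth_space :: "(real \<Rightarrow> real) \<Rightarrow> (complex \<Rightarrow> complex) set" where
  "growth_space \<omega> =
     {f. f holomorphic_on UNIV \<and> bdd_above (range (\<lambda>z. cmod (f z) / \<omega> (cmod z)))}"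

definition growth_norm :: "(real \<Rightarrow> real) \<Rightarrow> (complex \<Rightarrow> complex) \<Rightarrow> real" where
  "growth_norm \<omega> f = (SUP z. cmod (f z) / \<omega> (cmod z))"

text \<open>The supremum defining the associated weight at \<open>z\<close> depends on \<open>cmod z\<close> only, so the
  point \<open>of_real t\<close> represents the circle of radius \<open>t\<close>; see the lemma below.\<close>

definition associated_weight :: "(real \<Rightarrow> real) \<Rightarrow> real \<Rightarrow> real" where
  "associated_weight \<omega> t =
     Sup {cmod (f (of_real t)) | f. f holomorphic_on UNIV \<and> (\<forall>w. cmod (f w) \<le> \<omega> (cmod w))}"

lemma associated_weight_cmod:
  "associated_weight \<omega> (cmod z) =
     Sup {cmod (f z) | f. f holomorphic_on UNIV \<and> (\<forall>w. cmod (f w) \<le> \<omega> (cmod w))}"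
proof -
  let ?B = "{f. f holomorphic_on UNIV \<and> (\<forall>w. cmod (f w) \<le> \<omega> (cmod w))}"
  have rot: "(\<lambda>w. f (u * w)) \<in> ?B" if "f \<in> ?B" "cmod u = 1" for f u
  proof -
    have "(f \<circ> (\<lambda>w. u * w)) holomorphic_on UNIV"
      using that by (intro holomorphic_on_compose_gen[where t = UNIV] holomorphic_intros) auto
    moreover have "cmod (f (u * w)) \<le> \<omega> (cmod w)" for w
    proof -
      have "cmod (f (u * w)) \<le> \<omega> (cmod (u * w))" using that by blast
      then show ?thesis using that by (simp add: norm_mult)
    qed
    ultimately show ?thesis by (simp add: o_def)
  qed
  obtain u where u: "cmod u = 1" "z = u * of_real (cmod z)"
    by (metis mult.commute norm_cis rcis_cmod_Arg rcis_def)
  obtain v where v: "cmod v = 1" "of_real (cmod z) = v * z"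
  proof
    show "cmod (inverse u) = 1" using u by (simp add: norm_inverse)
    show "of_real (cmod z) = inverse u * z"
      using u by (metis mult.assoc left_inverse mult_1 norm_zero zero_neq_one)
  qed
  have "(\<lambda>f. cmod (f (of_real (cmod z)))) ` ?B = (\<lambda>f. cmod (f z)) ` ?B"
  proof (intro equalityI image_subsetI)
    fix f assume f: "f \<in> ?B"
    show "cmod (f (of_real (cmod z))) \<in> (\<lambda>f. cmod (f z)) ` ?B"
      using rot[OF f v(1)] v(2) by (intro image_eqI[where x = "\<lambda>w. f (v * w)"]) auto
    show "cmod (f z) \<in> (\<lambda>f. cmod (f (of_real (cmod z)))) ` ?B"
      using rot[OF f u(1)] u(2) by (intro image_eqI[where x = "\<lambda>w. f (u * w)"]) auto
  qed
  then show ?thesis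
    unfolding associated_weight_def by (simp add: setcompr_eq_image)
qed

text \<open>The exponent \<open>q\<close> ranges over \<open>(0, \<infinity>]\<close>, rendered as \<^typ>\<open>ereal\<close>.\<close>

definition fock_space :: "real \<Rightarrow> ereal \<Rightarrow> (complex \<Rightarrow> complex) set" where
  "fock_space \<alpha> q =
     {f. f holomorphic_on UNIV \<and>
         (if q = \<infinity> then bdd_above (range (\<lambda>z. cmod (f z) * exp (- (\<alpha> / 2) * (cmod z)\<^sup>2)))
          else integrable lebesgue
                 (\<lambda>z. cmod (f z) powr real_of_ereal q *
                      exp (- (\<alpha> * real_of_ereal q / 2) * (cmod z)\<^sup>2)))}"

definition fock_norm :: "real \<Rightarrow> ereal \<Rightarrow> (complex \<Rightarrow> complex) \<Rightarrow> real" where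
  "fock_norm \<alpha> q f =
     (if q = \<infinity> then (SUP z. cmod (f z) * exp (- (\<alpha> / 2) * (cmod z)\<^sup>2))
      else (\<alpha> * real_of_ereal q / (2 * pi) *
            (LINT z|lebesgue. cmod (f z) powr real_of_ereal q *
               exp (- (\<alpha> * real_of_ereal q / 2) * (cmod z)\<^sup>2)))
           powr (1 / real_of_ereal q))"

definition volterra :: "(complex \<Rightarrow> complex) \<Rightarrow> (complex \<Rightarrow> complex) \<Rightarrow> complex \<Rightarrow> complex" where
  "volterra g f z = contour_integral (linepath 0 z) (\<lambda>\<xi>. f \<xi> * deriv g \<xi>)"

definition composition_op :: "(complex \<Rightarrow> complex) \<Rightarrow> (complex \<Rightarrow> complex) \<Rightarrow> complex \<Rightarrow> complex" where
  "composition_op \<phi> f = f \<circ> \<phi>"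

definition comp_volterra ::
  "(complex \<Rightarrow> complex) \<Rightarrow> (complex \<Rightarrow> complex) \<Rightarrow> (complex \<Rightarrow> complex) \<Rightarrow> complex \<Rightarrow> complex" where
  "comp_volterra \<phi> g = composition_op \<phi> \<circ> volterra g"

text \<open>Bounded linear operators between (quasi-)normed spaces of functions, each given by its
  carrier and its (quasi-)norm. The target is only quasi-normed when \<open>0 < q < 1\<close>.\<close>

definition bounded_operator ::
  "(complex \<Rightarrow> complex) set \<Rightarrow> ((complex \<Rightarrow> complex) \<Rightarrow> real) \<Rightarrow>
   (complex \<Rightarrow> complex) set \<Rightarrow> ((complex \<Rightarrow> complex) \<Rightarrow> real) \<Rightarrow>
   ((complex \<Rightarrow> complex) \<Rightarrow> complex \<Rightarrow> complex) \<Rightarrow> bool" where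
  "bounded_operator X nX Y nY T \<longleftrightarrow>
     (\<forall>f\<in>X. T f \<in> Y) \<and>
     (\<forall>f\<in>X. \<forall>h\<in>X. T (\<lambda>z. f z + h z) = (\<lambda>z. T f z + T h z)) \<and>
     (\<forall>c. \<forall>f\<in>X. T (\<lambda>z. c * f z) = (\<lambda>z. c * T f z)) \<and>
     (\<exists>K. \<forall>f\<in>X. nY (T f) \<le> K * nX f)"

definition Lq :: "ereal \<Rightarrow> 'a measure \<Rightarrow> ('a \<Rightarrow> real) set" where
  "Lq q M =
     {h. h \<in> borel_measurable M \<and>
         (if q = \<infinity> then (\<exists>K. AE x in M. \<bar>h x\<bar> \<le> K)
          else integrable M (\<lambda>x. \<bar>h x\<bar> powr real_of_ereal q))}"

end

theory Submission
  imports Defs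
begin

text \<open>Writing \<open>T\<close> for the operator, \<open>(T f)' = (f \<circ> \<phi>) (g' \<circ> \<phi>) \<phi>'\<close>. A Littlewood--Paley description of the
  Fock space, valid for all \<open>0 < q \<le> \<infinity>\<close>, says that \<open>F\<close> belongs to it iff \<open>|F'| / (1 + |z|)\<close> times
  the Gaussian is in \<open>L\<^sup>q\<close>; together with \<open>|f| \<le> \<parallel>f\<parallel> \<omega>'\<close>, \<open>\<omega>'\<close> the associated weight, this gives
  (ii) implies (i). For the converse one needs finitely many functions in the growth space whose moduli add
  up to at least a multiple of \<open>\<omega>'\<close>. With \<open>a\<^sub>n = inf \<omega>(t) / t\<^sup>n\<close>, the associated weight is comparable to
  \<open>sup a\<^sub>n t\<^sup>n\<close>. Thinning out the exponents until the remaining monomials separate, while keeping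
  the supremum up to a factor, and splitting the rest into three residue classes yields three
  lacunary series, one of which is always dominated by a single large term.\<close>

section \<open>Entire functions and their derivatives in Gaussian norms\<close>

text \<open>A single test function cannot replace the family: if its modulus were at least a
  multiple of the associated weight, its reciprocal would be entire and tend to 0 at infinity,
  contradicting Liouville. The scale of all local estimates is \<open>1 / (1 + |z|)\<close>: moving
  a point that far changes the Gaussian only by a constant factor. The obstacle for
  \<open>q < 1\<close> is to recover \<open>F\<close> from \<open>F'\<close>, since integrating
  along rays and applying Minkowski's inequality is available only for \<open>q \<ge> 1\<close>.
  Instead, thin annuli are compared with slightly shrunk ones; the fixed gain in the Gaussian gives
  a contraction whose error involves only \<open>F'\<close>. The factor 5 used in thinning out the
  exponents makes the terms on both sides of the dominating one add up to at most
  \<open>2 * (1 / 5) / (1 - 1 / 5) = 1 / 2\<close> of it. Three residue classes arise because below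
  the peak one step gains this factor, above it two steps do, and a stride that crosses the peak may
  waste one step.\<close>

lemma emeasure_lborel_ball_complex:
  fixes z :: complex
  assumes "0 \<le> r"
  shows "emeasure lborel (ball z r) = ennreal (pi * r\<^sup>2)"
  using emeasure_ball[OF assms, of z] unit_ball_vol_2 by simp

lemma norm_deriv_le:
  assumes "F holomorphic_on UNIV" "0 < r" "\<And>w. cmod (w - z) \<le> r \<Longrightarrow> cmod (F w) \<le> B"
  shows "cmod (deriv F z) \<le> B / r"
  using Cauchy_inequality[of F z r B 1] assms
  by (auto simp: norm_minus_commute intro: holomorphic_on_subset
      holomorphic_on_imp_continuous_on continuous_on_subset)

text \<open>Hardy--Littlewood: the maximum of \<open>|F|\<^sup>q (\<rho> - |w - z|)\<^sup>2\<close> is attained at some \<open>w\<^sub>0\<close>; on a disc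
  about \<open>w\<^sub>0\<close> of radius comparable to \<open>\<rho> - |w\<^sub>0 - z|\<close> the function \<open>|F|\<close> is bounded, hence by
  Cauchy's estimate at least \<open>|F w\<^sub>0| / 2\<close> on a smaller disc. Thus no subharmonicity of
  \<open>|F|\<^sup>q\<close> is needed when \<open>q < 1\<close>.\<close>

lemma powr_le_nn_integral_ball:
  fixes q :: real
  assumes q: "0 < q"
  obtains C where "0 < C" and "\<And>F z \<rho>. F holomorphic_on UNIV \<Longrightarrow> 0 < \<rho> \<Longrightarrow>
     ennreal (cmod (F z) powr q * \<rho>\<^sup>2) \<le>
       ennreal C * (\<integral>\<^sup>+w. ennreal (cmod (F w) powr q) * indicator (ball z \<rho>) w \<partial>lborel)"
proof -
  \<comment> \<open>Chosen so that \<open>(B * A) powr q = 4 * A powr q\<close>; the 4 is lost by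
    replacing \<open>\<rho> - cmod (v - z)\<close> by its lower bound \<open>d / 2\<close> in the
    squared factor.\<close>
  define B where "B = 4 powr (1 / q)"
  have B1: "1 \<le> B" unfolding B_def using q by (simp add: ge_one_powr_ge_zero)
  \<comment> \<open>The factor \<open>2 powr q\<close> pays for using \<open>A / 2\<close> instead
    of \<open>A\<close>, and \<open>64 * B\<^sup>2 / pi\<close> is \<open>d\<^sup>2\<close> divided
    by the area of the disc of radius \<open>e = d / (8 * B)\<close>.\<close>
  define C where "C = 2 powr q * (64 * B\<^sup>2 / pi)"
  have C0: "0 < C" unfolding C_def using B1 by simp
  have "ennreal (cmod (F z) powr q * \<rho>\<^sup>2) \<le>
       ennreal C * (\<integral>\<^sup>+w. ennreal (cmod (F w) powr q) * indicator (ball z \<rho>) w \<partial>lborel)"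
    if F: "F holomorphic_on UNIV" and rho: "0 < \<rho>" for F :: "complex \<Rightarrow> complex" and z \<rho>
  proof (cases "F z = 0")
    case False
    have cF: "continuous_on S F" for S
      using F holomorphic_on_imp_continuous_on continuous_on_subset by blast
    let ?G = "\<lambda>w. cmod (F w) powr q * (\<rho> - cmod (w - z))\<^sup>2"
    have "continuous_on (cball z \<rho>) ?G"
      using q by (intro continuous_intros cF continuous_on_powr') auto
    then obtain w0 where w0: "w0 \<in> cball z \<rho>" and max: "\<And>w. w \<in> cball z \<rho> \<Longrightarrow> ?G w \<le> ?G w0"
      using continuous_attains_sup[of "cball z \<rho>" ?G] rho by auto
    define d where "d = \<rho> - cmod (w0 - z)"
    define A where "A = cmod (F w0)"
    have Gz: "cmod (F z) powr q * \<rho>\<^sup>2 \<le> A powr q * d\<^sup>2"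
      using max[of z] rho by (simp add: d_def A_def)
    moreover have "0 < cmod (F z) powr q * \<rho>\<^sup>2" using False rho by simp
    ultimately have "0 < A powr q * d\<^sup>2" by linarith
    moreover have "0 \<le> d" using w0 by (simp add: d_def dist_norm norm_minus_commute)
    ultimately have d0: "0 < d" and A0: "0 < A"
      by (auto simp: A_def zero_less_mult_iff less_le)
    have bd: "cmod (F v) \<le> B * A" if "cmod (v - w0) \<le> d / 2" for v
    proof -
      have vz: "cmod (v - z) \<le> cmod (w0 - z) + d / 2"
        using that norm_triangle_ineq[of "v - w0" "w0 - z"] by simp
      moreover have "cmod (w0 - z) = \<rho> - d" by (simp add: d_def)
      ultimately have dv: "d / 2 \<le> \<rho> - cmod (v - z)" by linarith
      then have "v \<in> cball z \<rho>" using d0 by (simp add: dist_norm norm_minus_commute)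
      from max[OF this] have "?G v \<le> A powr q * d\<^sup>2" by (simp add: A_def d_def)
      moreover have "cmod (F v) powr q * (d / 2)\<^sup>2 \<le> ?G v"
        using dv d0 by (intro mult_left_mono power_mono) auto
      ultimately have "cmod (F v) powr q * (d / 2)\<^sup>2 \<le> A powr q * d\<^sup>2" by linarith
      then have "cmod (F v) powr q \<le> 4 * A powr q"
        using d0 by (simp add: power2_eq_square field_simps)
      also have "\<dots> = (B * A) powr q"
        using q by (simp add: B_def powr_mult powr_powr A_def)
      finally show ?thesis
        using q B1 A0 powr_less_mono2[of q "B * A" "cmod (F v)"] by (force simp: not_less)
    qed
    \<comment> \<open>Cauchy's estimate gives \<open>4 * B * A / d\<close> for the derivative near
      \<open>w0\<close>, so over a distance \<open>e\<close> the function changes by at most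
      \<open>A / 2\<close>.\<close>
    define e where "e = d / (8 * B)"
    have e0: "0 < e" and e8: "e \<le> d / 8"
      using d0 B1 by (auto simp: e_def field_simps)
    have low: "A / 2 \<le> cmod (F u)" if u: "cmod (u - w0) < e" for u
    proof -
      have der: "cmod (deriv F v) \<le> B * A / (d / 4)" if "v \<in> ball w0 (d / 4)" for v
      proof (rule norm_deriv_le[OF F])
        fix w assume "cmod (w - v) \<le> d / 4"
        then have "cmod (w - w0) \<le> d / 2"
          using that norm_triangle_ineq[of "w - v" "v - w0"] by (simp add: dist_norm norm_minus_commute)
        then show "cmod (F w) \<le> B * A" by (rule bd)
      qed (use d0 in auto)
      have "cmod (F u - F w0) \<le> B * A / (d / 4) * cmod (u - w0)"
      proof (rule field_differentiable_bound[where S = "ball w0 (d / 4)" and f' = "deriv F"])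
        show "(F has_field_derivative deriv F v) (at v within ball w0 (d / 4))" for v
          using F by (meson UNIV_I holomorphic_derivI open_UNIV)
        show "u \<in> ball w0 (d / 4)" using u e8 d0 by (simp add: dist_norm norm_minus_commute)
      qed (use der d0 in auto)
      also have "\<dots> \<le> B * A / (d / 4) * e"
        using u B1 A0 d0 by (intro mult_left_mono) auto
      also have "\<dots> = A / 2" using d0 B1 by (simp add: e_def field_simps)
      finally show ?thesis
        using norm_triangle_ineq2[of "F w0" "F u"] by (simp add: A_def norm_minus_commute)
    qed
    have sub: "ball w0 e \<subseteq> ball z \<rho>"
    proof
      fix u assume "u \<in> ball w0 e"
      then show "u \<in> ball z \<rho>"
        using norm_triangle_ineq[of "u - w0" "w0 - z"] e8 d0
        by (simp add: dist_norm norm_minus_commute d_def)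
    qed
    have "A powr q * d\<^sup>2 = C * ((A / 2) powr q * (pi * e\<^sup>2))"
      using B1 d0 A0 by (simp add: C_def e_def powr_divide power2_eq_square field_simps)
    then have "ennreal (cmod (F z) powr q * \<rho>\<^sup>2) \<le> ennreal (C * ((A / 2) powr q * (pi * e\<^sup>2)))"
      using Gz by (intro ennreal_leI) simp
    also have "\<dots> = ennreal C * (\<integral>\<^sup>+w. ennreal ((A / 2) powr q) * indicator (ball w0 e) w \<partial>lborel)"
      using C0 A0 e0 emeasure_lborel_ball_complex[of e w0]
      by (simp add: nn_integral_cmult_indicator ennreal_mult)
    also have "\<dots> \<le> ennreal C * (\<integral>\<^sup>+w. ennreal (cmod (F w) powr q) * indicator (ball z \<rho>) w \<partial>lborel)"
    proof (intro mult_left_mono nn_integral_mono)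
      fix w
      show "ennreal ((A / 2) powr q) * indicator (ball w0 e) w \<le>
          ennreal (cmod (F w) powr q) * indicator (ball z \<rho>) w"
        using low[of w] sub A0 q
        by (auto split: split_indicator simp: dist_norm norm_minus_commute intro!: ennreal_leI powr_mono2)
    qed simp
    finally show ?thesis .
  qed (use q in simp)
  with C0 that show ?thesis by blast
qed

section \<open>Averages over discs on the scale of the Gaussian\<close>

text \<open>With \<open>d = cmod (z - w)\<close>, the increase of the squared modulus is at most
  \<open>2 * d * (1 + cmod z) + d * (d - 2)\<close>, and the radius is such that the two summands
  are at most 6 and 3. The two comparisons with factor 4 allow the roles of centre and point to be
  exchanged.\<close>

lemma norm_compare_disc:
  fixes z w :: complex
  assumes "cmod (z - w) < 3 / (1 + cmod z)"
  shows "1 + cmod z \<le> 4 * (1 + cmod w)" "1 + cmod w \<le> 4 * (1 + cmod z)"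
    and "(cmod w)\<^sup>2 \<le> (cmod z)\<^sup>2 + 9"
proof -
  have "3 / (1 + cmod z) \<le> 3"
    using divide_left_mono[of 1 "1 + cmod z" 3] by (simp add: add_pos_nonneg)
  then have d3: "cmod (z - w) < 3" using assms by linarith
  have tri: "cmod z \<le> cmod w + cmod (z - w)" "cmod w \<le> cmod z + cmod (z - w)"
    using norm_triangle_ineq2[of z w] norm_triangle_ineq2[of w z] by (simp_all add: norm_minus_commute)
  note nn = norm_ge_zero[of z] norm_ge_zero[of w]
  show "1 + cmod z \<le> 4 * (1 + cmod w)" "1 + cmod w \<le> 4 * (1 + cmod z)"
    using tri d3 nn unfolding distrib_left by linarith+
  define d where "d = cmod (z - w)"
  have d: "0 \<le> d" "d * (1 + cmod z) \<le> 3" "d \<le> 3"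
    using assms d3 nn by (auto simp: d_def field_simps add_pos_nonneg)
  have "(cmod w)\<^sup>2 \<le> (cmod z + d)\<^sup>2" using tri nn by (intro power_mono) (auto simp: d_def)
  also have "\<dots> = (cmod z)\<^sup>2 + 2 * (d * (1 + cmod z)) + d * (d - 2)"
    by (simp add: power2_eq_square algebra_simps)
  also have "d * (d - 2) \<le> 3 * 1"
    using d mult_nonpos_nonneg[of "d - 3" "d + 1"] by (simp add: algebra_simps)
  finally show "(cmod w)\<^sup>2 \<le> (cmod z)\<^sup>2 + 9" using d by simp
qed

text \<open>Up to the factor \<open>9 * pi\<close> this is the mean value of \<open>h\<close> over
  the disc, whose area is \<open>9 * pi / (1 + cmod z)\<^sup>2\<close>.\<close>

definition disc_average :: "(complex \<Rightarrow> ennreal) \<Rightarrow> complex \<Rightarrow> ennreal" where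
  "disc_average h z = ennreal ((1 + cmod z)\<^sup>2) *
     (\<integral>\<^sup>+w. h w * indicator (ball z (3 / (1 + cmod z))) w \<partial>lborel)"

lemma indicator_ball_measurable:
  "(\<lambda>(z, w). indicator (ball z (3 / (1 + cmod z))) w :: ennreal)
     \<in> borel_measurable (lborel \<Otimes>\<^sub>M lborel)"
proof -
  have eq: "(\<lambda>(z, w). indicator (ball z (3 / (1 + cmod z))) w :: ennreal)
      = indicator {p. dist (fst p) (snd p) < 3 / (1 + cmod (fst p))}"
    by (auto simp: fun_eq_iff split: split_indicator)
  have ne: "1 + cmod u \<noteq> 0" for u
    using norm_ge_zero[of u] by linarith
  have "open {p :: complex \<times> complex. dist (fst p) (snd p) < 3 / (1 + cmod (fst p))}"
    using ne by (intro open_Collect_less continuous_intros) auto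
  then have "{p :: complex \<times> complex. dist (fst p) (snd p) < 3 / (1 + cmod (fst p))} \<in> sets (lborel \<Otimes>\<^sub>M lborel)"
    unfolding lborel_prod by simp
  then show ?thesis unfolding eq by (rule borel_measurable_indicator)
qed

lemma disc_average_measurable [measurable]:
  assumes [measurable]: "h \<in> borel_measurable borel"
  shows "disc_average h \<in> borel_measurable borel"
proof -
  note [measurable] = indicator_ball_measurable
  have "(\<lambda>z. \<integral>\<^sup>+w. h w * indicator (ball z (3 / (1 + cmod z))) w \<partial>lborel) \<in> borel_measurable lborel"
    by measurable
  then have [measurable]: "(\<lambda>z. \<integral>\<^sup>+w. h w * indicator (ball z (3 / (1 + cmod z))) w \<partial>lborel) \<in> borel_measurable borel"
    by simp
  show ?thesis unfolding disc_average_def by measurable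
qed

text \<open>By Tonelli, \<open>h w\<close> is weighted by the integral of
  \<open>(1 + cmod z)\<^sup>2\<close> over all \<open>z\<close> whose disc contains
  \<open>w\<close>. With \<open>s = 1 + cmod w\<close> these \<open>z\<close> lie within
  \<open>12 / s\<close> of \<open>w\<close>, and there the integrand is at most
  \<open>16 * s\<^sup>2\<close>; this gives \<open>16 * 144 * pi\<close>.\<close>

lemma nn_integral_disc_average_le:
  assumes [measurable]: "h \<in> borel_measurable borel"
  shows "(\<integral>\<^sup>+z. disc_average h z \<partial>lborel) \<le> ennreal (2304 * pi) * (\<integral>\<^sup>+w. h w \<partial>lborel)"
proof -
  let ?I = "\<lambda>z w. indicator (ball z (3 / (1 + cmod z))) w :: ennreal"
  note [measurable] = indicator_ball_measurable
  have inner: "(\<integral>\<^sup>+z. ennreal ((1 + cmod z)\<^sup>2) * ?I z w \<partial>lborel) \<le> ennreal (2304 * pi)" for w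
  proof -
    define s where "s = 1 + cmod w"
    have s1: "1 \<le> s" by (simp add: s_def)
    have "(\<integral>\<^sup>+z. ennreal ((1 + cmod z)\<^sup>2) * ?I z w \<partial>lborel)
       \<le> (\<integral>\<^sup>+z. ennreal (16 * s\<^sup>2) * indicator (ball w (12 / s)) z \<partial>lborel)"
    proof (intro nn_integral_mono)
      fix z
      show "ennreal ((1 + cmod z)\<^sup>2) * ?I z w \<le> ennreal (16 * s\<^sup>2) * indicator (ball w (12 / s)) z"
      proof (cases "w \<in> ball z (3 / (1 + cmod z))")
        case True
        then have d: "cmod (z - w) < 3 / (1 + cmod z)" by (simp add: dist_norm)
        have a: "1 + cmod z \<le> 4 * s" "s \<le> 4 * (1 + cmod z)"
          using norm_compare_disc[OF d] by (simp_all add: s_def)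
        have "(1 + cmod z)\<^sup>2 \<le> (4 * s)\<^sup>2" using a by (intro power_mono) auto
        moreover have "3 / (1 + cmod z) \<le> 12 / s"
          using a s1 by (simp add: field_simps add_pos_nonneg)
        then have "z \<in> ball w (12 / s)" using d by (simp add: dist_norm norm_minus_commute)
        ultimately show ?thesis using True by (auto intro!: ennreal_leI simp: power_mult_distrib)
      qed auto
    qed
    also have "\<dots> = ennreal (16 * s\<^sup>2) * ennreal (pi * (12 / s)\<^sup>2)"
      using s1 by (simp add: nn_integral_cmult_indicator emeasure_lborel_ball_complex)
    also have "\<dots> = ennreal (2304 * pi)"
      using s1 by (simp flip: ennreal_mult add: power2_eq_square field_simps)
    finally show ?thesis .
  qed
  have "(\<integral>\<^sup>+z. disc_average h z \<partial>lborel)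
      = (\<integral>\<^sup>+z. (\<integral>\<^sup>+w. ennreal ((1 + cmod z)\<^sup>2) * (h w * ?I z w) \<partial>lborel) \<partial>lborel)"
    unfolding disc_average_def by (intro nn_integral_cong) (simp add: nn_integral_cmult)
  also have "\<dots> = (\<integral>\<^sup>+w. (\<integral>\<^sup>+z. ennreal ((1 + cmod z)\<^sup>2) * (h w * ?I z w) \<partial>lborel) \<partial>lborel)"
    by (rule lborel_pair.Fubini'[symmetric]) measurable
  also have "\<dots> = (\<integral>\<^sup>+w. h w * (\<integral>\<^sup>+z. ennreal ((1 + cmod z)\<^sup>2) * ?I z w \<partial>lborel) \<partial>lborel)"
  proof (intro nn_integral_cong)
    fix w
    have [measurable]: "(\<lambda>z. ?I z w) \<in> borel_measurable lborel"
      using measurable_compose[OF measurable_Pair2' indicator_ball_measurable, of w] by simp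
    show "(\<integral>\<^sup>+z. ennreal ((1 + cmod z)\<^sup>2) * (h w * ?I z w) \<partial>lborel)
        = h w * (\<integral>\<^sup>+z. ennreal ((1 + cmod z)\<^sup>2) * ?I z w \<partial>lborel)"
      by (subst nn_integral_cmult[symmetric]) (auto simp: mult_ac)
  qed
  also have "\<dots> \<le> (\<integral>\<^sup>+w. h w * ennreal (2304 * pi) \<partial>lborel)"
    by (intro nn_integral_mono mult_left_mono inner) simp
  also have "\<dots> = ennreal (2304 * pi) * (\<integral>\<^sup>+w. h w \<partial>lborel)"
    by (simp add: nn_integral_multc mult.commute)
  finally show ?thesis .
qed

text \<open>A disc of radius \<open>1 / (1 + cmod z)\<close> about \<open>w\<close> stays in the
  disc of radius \<open>3 / (1 + cmod z)\<close> about \<open>z\<close> over which the average is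
  taken. The freedom in \<open>w\<close> allows a maximum of the modulus near \<open>z\<close> to be
  controlled by one average at \<open>z\<close>.\<close>

lemma powr_times_weight_le_disc_average:
  fixes q M :: real
  assumes q: "0 < q" and M: "0 < M" and V0: "\<And>z. 0 \<le> V z"
    and [measurable]: "V \<in> borel_measurable borel"
    and V: "\<And>z w. cmod (z - w) < 3 / (1 + cmod z) \<Longrightarrow> V z \<le> M * V w"
  obtains C where "0 < C" and "\<And>F z w. F holomorphic_on UNIV \<Longrightarrow> cmod (w - z) \<le> 2 / (1 + cmod z) \<Longrightarrow>
     ennreal (cmod (F w) powr q * V z) \<le>
       ennreal C * disc_average (\<lambda>u. ennreal (cmod (F u) powr q * V u)) z"
proof -
  obtain C where C: "0 < C" and loc: "\<And>F z \<rho>. F holomorphic_on UNIV \<Longrightarrow> 0 < \<rho> \<Longrightarrow>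
     ennreal (cmod (F z) powr q * \<rho>\<^sup>2) \<le>
       ennreal C * (\<integral>\<^sup>+w. ennreal (cmod (F w) powr q) * indicator (ball z \<rho>) w \<partial>lborel)"
    using powr_le_nn_integral_ball[OF q] by blast
  have "ennreal (cmod (F w) powr q * V z) \<le>
       ennreal (C * M) * disc_average (\<lambda>u. ennreal (cmod (F u) powr q * V u)) z"
    if F: "F holomorphic_on UNIV" and w: "cmod (w - z) \<le> 2 / (1 + cmod z)" for F z w
  proof -
    define s where "s = 1 + cmod z"
    have s: "1 \<le> s" by (simp add: s_def)
    have cF: "continuous_on UNIV F" using F by (rule holomorphic_on_imp_continuous_on)
    have [measurable]: "F \<in> borel_measurable borel" using cF by (rule borel_measurable_continuous_onI)
    have [measurable]: "ball w (1 / s) \<in> sets borel" by simp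
    have meas: "(\<lambda>u. ennreal (cmod (F u) powr q) * indicator (ball w (1 / s)) u) \<in> borel_measurable borel"
      by measurable
    have [measurable]: "ball z (3 / s) \<in> sets borel" by simp
    have meas2: "(\<lambda>u. ennreal (cmod (F u) powr q * V u) * indicator (ball z (3 / s)) u) \<in> borel_measurable borel"
      by measurable
    have "ennreal (cmod (F w) powr q * V z) = ennreal (s\<^sup>2 * V z) * ennreal (cmod (F w) powr q * (1 / s)\<^sup>2)"
      using s V0[of z] by (simp flip: ennreal_mult add: power_divide)
    also have "\<dots> \<le> ennreal (s\<^sup>2 * V z) *
        (ennreal C * (\<integral>\<^sup>+u. ennreal (cmod (F u) powr q) * indicator (ball w (1 / s)) u \<partial>lborel))"
      using s by (intro mult_left_mono loc F) auto
    also have "\<dots> = ennreal C * ennreal (s\<^sup>2) *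
        (\<integral>\<^sup>+u. ennreal (V z) * (ennreal (cmod (F u) powr q) * indicator (ball w (1 / s)) u) \<partial>lborel)"
      using V0[of z] by (subst nn_integral_cmult) (auto simp: meas ennreal_mult mult_ac)
    also have "\<dots> \<le> ennreal C * ennreal (s\<^sup>2) *
        (\<integral>\<^sup>+u. ennreal M * (ennreal (cmod (F u) powr q * V u) * indicator (ball z (3 / s)) u) \<partial>lborel)"
    proof (intro mult_left_mono nn_integral_mono)
      fix u
      show "ennreal (V z) * (ennreal (cmod (F u) powr q) * indicator (ball w (1 / s)) u)
          \<le> ennreal M * (ennreal (cmod (F u) powr q * V u) * indicator (ball z (3 / s)) u)"
      proof (cases "u \<in> ball w (1 / s)")
        case True
        then have "cmod (w - u) < 1 / s" by (simp add: dist_norm)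
        then have "cmod (z - u) < 2 / s + 1 / s"
          using w norm_triangle_ineq[of "z - w" "w - u"] by (simp add: s_def norm_minus_commute)
        then have d: "cmod (z - u) < 3 / s" by (simp flip: add_divide_distrib)
        then have "V z \<le> M * V u" using V by (simp add: s_def)
        then have "V z * cmod (F u) powr q \<le> M * V u * cmod (F u) powr q"
          by (rule mult_right_mono) simp
        then show ?thesis using d True V0 M
          by (auto simp: dist_norm mult_ac ennreal_mult[symmetric] intro!: ennreal_leI)
      qed auto
    qed auto
    also have "\<dots> = ennreal C * ennreal (s\<^sup>2) * (ennreal M *
        (\<integral>\<^sup>+u. ennreal (cmod (F u) powr q * V u) * indicator (ball z (3 / s)) u \<partial>lborel))"
      by (subst nn_integral_cmult) (auto simp: meas2)
    also have "\<dots> = ennreal (C * M) * disc_average (\<lambda>u. ennreal (cmod (F u) powr q * V u)) z"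
      using C M by (simp add: disc_average_def s_def ennreal_mult mult_ac)
    finally show ?thesis .
  qed
  then show ?thesis using C M that[of "C * M"] by simp
qed

lemma nn_integral_lborel_scaleR:
  fixes h :: "complex \<Rightarrow> ennreal"
  assumes [measurable]: "h \<in> borel_measurable borel" and "c \<noteq> 0"
  shows "(\<integral>\<^sup>+z. h z \<partial>lborel) = ennreal (c\<^sup>2) * (\<integral>\<^sup>+z. h (c *\<^sub>R z) \<partial>lborel)"
  by (subst lborel_affine[OF \<open>c \<noteq> 0\<close>, of 0])
    (simp add: nn_integral_density nn_integral_distr nn_integral_cmult)

lemma sq_exp_weight_compare:
  fixes a q :: real
  assumes "0 \<le> a" "0 \<le> q" "cmod (z - w) < 3 / (1 + cmod z)"
  shows "exp (- a * (cmod z)\<^sup>2) \<le> exp (9 * a) * exp (- a * (cmod w)\<^sup>2)"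
    and "exp (- a * (cmod z)\<^sup>2) / (1 + cmod z) powr q
          \<le> exp (9 * a) * 4 powr q * (exp (- a * (cmod w)\<^sup>2) / (1 + cmod w) powr q)"
proof -
  note n = norm_compare_disc[OF assms(3)]
  have "a * (cmod w)\<^sup>2 \<le> a * ((cmod z)\<^sup>2 + 9)"
    using n assms by (intro mult_left_mono) auto
  then show 1: "exp (- a * (cmod z)\<^sup>2) \<le> exp (9 * a) * exp (- a * (cmod w)\<^sup>2)"
    by (simp flip: exp_add add: algebra_simps)
  have "(1 + cmod w) powr q \<le> (4 * (1 + cmod z)) powr q"
    using n assms by (intro powr_mono2) auto
  then have "1 / (1 + cmod z) powr q \<le> 4 powr q / (1 + cmod w) powr q"
    unfolding powr_mult using norm_ge_zero[of z] norm_ge_zero[of w]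
    by (simp add: divide_simps add_nonneg_eq_0_iff mult.commute)
  from mult_mono[OF 1 this]
  show "exp (- a * (cmod z)\<^sup>2) / (1 + cmod z) powr q
          \<le> exp (9 * a) * 4 powr q * (exp (- a * (cmod w)\<^sup>2) / (1 + cmod w) powr q)"
    by (simp add: mult_ac)
qed

lemma cmod_attains_max_cball:
  fixes F :: "complex \<Rightarrow> complex"
  assumes "continuous_on UNIV F" "0 \<le> r"
  obtains w where "cmod (w - z) \<le> r" and "\<And>v. cmod (v - z) \<le> r \<Longrightarrow> cmod (F v) \<le> cmod (F w)"
proof -
  have "continuous_on (cball z r) (\<lambda>v. cmod (F v))"
    using assms by (intro continuous_on_norm) (rule continuous_on_subset, auto)
  then obtain w where "w \<in> cball z r" "\<And>v. v \<in> cball z r \<Longrightarrow> cmod (F v) \<le> cmod (F w)"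
    using continuous_attains_sup[of "cball z r" "\<lambda>v. cmod (F v)"] assms by auto
  then show ?thesis using that by (auto simp: dist_norm norm_minus_commute)
qed

text \<open>Cauchy's estimate on the disc of radius \<open>1 / (1 + cmod z)\<close> bounds
  \<open>cmod (deriv F z) / (1 + cmod z)\<close> by the maximum of \<open>cmod (F w)\<close> there.
  The disc average dominates its weighted power, and integrating the averages costs only a
  constant.\<close>

lemma nn_integral_deriv_le:
  fixes q a :: real
  assumes q: "0 < q" and a: "0 < a"
  obtains C where "0 < C" and "\<And>F. F holomorphic_on UNIV \<Longrightarrow>
     (\<integral>\<^sup>+z. ennreal ((cmod (deriv F z) / (1 + cmod z)) powr q * exp (- a * (cmod z)\<^sup>2)) \<partial>lborel)
       \<le> ennreal C * (\<integral>\<^sup>+z. ennreal (cmod (F z) powr q * exp (- a * (cmod z)\<^sup>2)) \<partial>lborel)"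
proof -
  let ?V = "\<lambda>z. exp (- a * (cmod z)\<^sup>2)"
  obtain C where C: "0 < C" and av: "\<And>F z w. F holomorphic_on UNIV \<Longrightarrow> cmod (w - z) \<le> 2 / (1 + cmod z) \<Longrightarrow>
     ennreal (cmod (F w) powr q * ?V z) \<le> ennreal C * disc_average (\<lambda>u. ennreal (cmod (F u) powr q * ?V u)) z"
    by (rule powr_times_weight_le_disc_average[OF q, of "exp (9 * a)" ?V])
      (use sq_exp_weight_compare(1)[of a 0] a in \<open>auto intro!: borel_measurable_continuous_onI continuous_intros\<close>)
  have "(\<integral>\<^sup>+z. ennreal ((cmod (deriv F z) / (1 + cmod z)) powr q * ?V z) \<partial>lborel)
       \<le> ennreal (C * (2304 * pi)) * (\<integral>\<^sup>+z. ennreal (cmod (F z) powr q * ?V z) \<partial>lborel)"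
    if F: "F holomorphic_on UNIV" for F
  proof -
    have cF: "continuous_on S F" for S
      using F holomorphic_on_imp_continuous_on continuous_on_subset by blast
    have [measurable]: "F \<in> borel_measurable borel" using cF by (rule borel_measurable_continuous_onI)
    let ?h = "\<lambda>u. ennreal (cmod (F u) powr q * ?V u)"
    have "(\<integral>\<^sup>+z. ennreal ((cmod (deriv F z) / (1 + cmod z)) powr q * ?V z) \<partial>lborel)
       \<le> (\<integral>\<^sup>+z. ennreal C * disc_average ?h z \<partial>lborel)"
    proof (intro nn_integral_mono)
      fix z
      define r where "r = 1 / (1 + cmod z)"
      have r: "0 < r" by (simp add: r_def add_pos_nonneg)
      obtain w where w: "cmod (w - z) \<le> r" and max: "\<And>v. cmod (v - z) \<le> r \<Longrightarrow> cmod (F v) \<le> cmod (F w)"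
        using cmod_attains_max_cball[OF cF[of UNIV], of r z] r by auto
      have "cmod (deriv F z) \<le> cmod (F w) / r"
        using max by (intro norm_deriv_le[OF F r])
      then have "cmod (deriv F z) / (1 + cmod z) \<le> cmod (F w)"
        by (simp add: r_def field_simps add_pos_nonneg)
      then have "(cmod (deriv F z) / (1 + cmod z)) powr q * ?V z \<le> cmod (F w) powr q * ?V z"
        using q by (intro mult_right_mono powr_mono2) auto
      moreover have "cmod (w - z) \<le> 2 / (1 + cmod z)"
        using w r by (simp add: r_def field_simps)
      ultimately show "ennreal ((cmod (deriv F z) / (1 + cmod z)) powr q * ?V z) \<le> ennreal C * disc_average ?h z"
        using av[OF F] by (meson ennreal_leI order_trans)
    qed
    also have "\<dots> = ennreal C * (\<integral>\<^sup>+z. disc_average ?h z \<partial>lborel)"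
      by (rule nn_integral_cmult) measurable
    also have "\<dots> \<le> ennreal C * (ennreal (2304 * pi) * (\<integral>\<^sup>+z. ?h z \<partial>lborel))"
      by (intro mult_left_mono nn_integral_disc_average_le) auto
    finally show ?thesis using C by (simp add: ennreal_mult mult_ac)
  qed
  then show ?thesis using C that[of "C * (2304 * pi)"] by simp
qed

section \<open>Recovering an entire function from its derivative by contraction over shells\<close>

text \<open>A substitute for the triangle inequality that covers every positive exponent. The
  coefficient of \<open>x powr q\<close> can be brought as close to 1 as desired, which is what
  keeps a contraction intact; the price is a large coefficient of the error term.\<close>

lemma powr_add_le_weighted:
  fixes x y :: real
  assumes "0 \<le> x" "0 \<le> y" "0 < \<epsilon>" "0 < q"
  shows "(x + y) powr q \<le> (1 + \<epsilon>) powr q * x powr q + (1 + 1 / \<epsilon>) powr q * y powr q"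
proof (cases "y \<le> \<epsilon> * x")
  case True
  then have "(x + y) powr q \<le> ((1 + \<epsilon>) * x) powr q"
    using assms by (intro powr_mono2) (auto simp: algebra_simps)
  then show ?thesis using assms by (simp add: powr_mult add_increasing2)
next
  case False
  then have "(x + y) powr q \<le> ((1 + 1 / \<epsilon>) * y) powr q"
    using assms by (intro powr_mono2) (auto simp: field_simps)
  then show ?thesis using assms by (simp add: powr_mult add_increasing)
qed

text \<open>Cutting by the square of the modulus adapts the shells to the Gaussian: neighbouring
  ones differ by a fixed factor in weight, their thickness is of order \<open>1 / |z|\<close>, and
  all have area \<open>pi\<close>.\<close>

definition shell :: "nat \<Rightarrow> complex set" where
  "shell k = {z. real k \<le> (cmod z)\<^sup>2 \<and> (cmod z)\<^sup>2 < real k + 1}"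

lemma shell_borel [measurable]: "shell k \<in> sets borel"
proof -
  have "(\<lambda>z::complex. (cmod z)\<^sup>2) \<in> borel_measurable borel" by measurable
  then show ?thesis unfolding shell_def by measurable
qed

text \<open>Dilation by \<open>sqrt (m / (m + 1))\<close> maps the shell \<open>m \<le> |z|\<^sup>2 < m + 1\<close> into the preceding one.
  It moves points by \<open>O(1 / |z|)\<close> only, but increases the weight by a fixed factor,
  so that integrals over shells contract up to an error controlled by the derivative.\<close>

lemma nn_integral_shell_step:
  fixes q a :: real
  assumes q: "0 < q" and a: "0 < a"
  obtains \<theta> K k0 where "0 < \<theta>" "\<theta> < 1" "0 < K" and "\<And>F k. F holomorphic_on UNIV \<Longrightarrow> k0 \<le> k \<Longrightarrow>
     (\<integral>\<^sup>+z. ennreal (cmod (F z) powr q * exp (- a * (cmod z)\<^sup>2)) * indicator (shell (Suc k)) z \<partial>lborel)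
     \<le> ennreal \<theta> * (\<integral>\<^sup>+z. ennreal (cmod (F z) powr q * exp (- a * (cmod z)\<^sup>2)) * indicator (shell k) z \<partial>lborel)
       + ennreal K * (\<integral>\<^sup>+z. disc_average (\<lambda>u. ennreal (cmod (deriv F u) powr q *
           (exp (- a * (cmod u)\<^sup>2) / (1 + cmod u) powr q))) z * indicator (shell (Suc k)) z \<partial>lborel)"
proof -
  let ?E = "\<lambda>z. exp (- a * (cmod z)\<^sup>2)"
  let ?V = "\<lambda>z. exp (- a * (cmod z)\<^sup>2) / (1 + cmod z) powr q"
  obtain C where C: "0 < C" and av: "\<And>F z w. F holomorphic_on UNIV \<Longrightarrow> cmod (w - z) \<le> 2 / (1 + cmod z) \<Longrightarrow>
     ennreal (cmod (F w) powr q * ?V z) \<le> ennreal C * disc_average (\<lambda>u. ennreal (cmod (F u) powr q * ?V u)) z"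
  proof (rule powr_times_weight_le_disc_average[OF q, of "exp (9 * a) * 4 powr q" ?V])
    show "?V z \<le> exp (9 * a) * 4 powr q * ?V w" if "cmod (z - w) < 3 / (1 + cmod z)" for z w
      using sq_exp_weight_compare(2)[OF _ _ that] a q by simp
    show "?V \<in> borel_measurable borel" by measurable
  qed auto
  \<comment> \<open>The budget of exponents: dilation gains \<open>exp (- a / 2)\<close>, splitting
    the sum costs \<open>(1 + \<epsilon>) powr q = exp (a / 8)\<close>, and the Jacobian
    \<open>1 / c\<^sup>2 = 1 + 1 / m\<close> costs at most \<open>exp (a / 8)\<close> once
    \<open>k \<ge> k0\<close>. What remains is the contraction factor
    \<open>exp (- a / 4)\<close>.\<close>
  define \<epsilon> where "\<epsilon> = exp (a / (8 * q)) - 1"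
  have eps: "0 < \<epsilon>" using a q by (simp add: \<epsilon>_def)
  have eps_q: "(1 + \<epsilon>) powr q = exp (a / 8)"
    using q by (simp add: \<epsilon>_def powr_def)
  define L where "L = (1 + 1 / \<epsilon>) powr q * 2 powr q"
  have "0 < 1 + 1 / \<epsilon>" using eps by (simp add: add_pos_pos)
  then have L: "0 < L" by (simp add: L_def)
  define k0 where "k0 = nat \<lceil>8 / a\<rceil>"
  have aux: "ennreal (x * y + u * v) = ennreal x * ennreal y + ennreal u * ennreal v"
    if "0 \<le> x" "0 \<le> y" "0 \<le> u" "0 \<le> v" for x y u v
    using that by (simp add: ennreal_mult)
  have step: "(\<integral>\<^sup>+z. ennreal (cmod (F z) powr q * ?E z) * indicator (shell (Suc k)) z \<partial>lborel)
     \<le> ennreal (exp (- a / 4)) * (\<integral>\<^sup>+z. ennreal (cmod (F z) powr q * ?E z) * indicator (shell k) z \<partial>lborel)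
       + ennreal (L * C) * (\<integral>\<^sup>+z. disc_average (\<lambda>u. ennreal (cmod (deriv F u) powr q * ?V u)) z
           * indicator (shell (Suc k)) z \<partial>lborel)"
    if F: "F holomorphic_on UNIV" and k: "k0 \<le> k" for F k
  proof -
    have dF: "deriv F holomorphic_on UNIV" using F by (simp add: holomorphic_deriv)
    have cF: "continuous_on UNIV F" "continuous_on UNIV (deriv F)"
      using F dF holomorphic_on_imp_continuous_on by auto
    have [measurable]: "F \<in> borel_measurable borel" "deriv F \<in> borel_measurable borel"
      using cF by (auto intro: borel_measurable_continuous_onI)
    define m where "m = real k + 1"
    have m1: "1 \<le> m" by (simp add: m_def)
    have m8: "1 / m \<le> a / 8"
    proof -
      have "8 / a \<le> real k0" unfolding k0_def by linarith
      also have "\<dots> \<le> m" using k by (simp add: m_def)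
      finally show ?thesis using a m1 by (simp add: field_simps)
    qed
    define c where "c = sqrt (m / (m + 1))"
    have c: "0 < c" "c \<le> 1" "c\<^sup>2 = m / (m + 1)" using m1 by (auto simp: c_def)
    let ?h = "\<lambda>z. ennreal (cmod (F z) powr q * ?E z) * indicator (shell k) z"
    let ?A = "disc_average (\<lambda>u. ennreal (cmod (deriv F u) powr q * ?V u))"
    have meas_h: "?h \<in> borel_measurable borel" by measurable
    have pt: "ennreal (cmod (F z) powr q * ?E z) * indicator (shell (Suc k)) z
        \<le> ennreal (exp (a / 8) * exp (- a / 2)) * ?h (c *\<^sub>R z)
          + ennreal (L * C) * (?A z * indicator (shell (Suc k)) z)" for z
    proof (cases "z \<in> shell (Suc k)")
      case True
      define r where "r = cmod z"
      have r: "m \<le> r\<^sup>2" "r\<^sup>2 < m + 1" "0 \<le> r" using True by (auto simp: shell_def m_def r_def)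
      have r1: "1 \<le> r" using r m1 by (simp add: power2_le_imp_le[of 1 r])
      have cr: "(cmod (c *\<^sub>R z))\<^sup>2 = r\<^sup>2 * m / (m + 1)"
        by (simp add: power_mult_distrib c r_def)
      have "m - 1 \<le> m * m / (m + 1)" using m1 by (simp add: field_simps)
      also have "\<dots> \<le> r\<^sup>2 * m / (m + 1)" using r m1 by (intro divide_right_mono mult_right_mono) auto
      finally have lo: "m - 1 \<le> (cmod (c *\<^sub>R z))\<^sup>2" unfolding cr .
      have hi: "(cmod (c *\<^sub>R z))\<^sup>2 < m"
        unfolding cr using r m1 mult_strict_left_mono[of "r\<^sup>2" "m + 1" m] by (simp add: field_simps)
      have in_shell: "c *\<^sub>R z \<in> shell k" using lo hi by (simp add: shell_def m_def)
      \<comment> \<open>The difference of the squared moduli is \<open>r\<^sup>2 / (m + 1)\<close>,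
        which is at least \<open>m / (m + 1)\<close>.\<close>
      have gap: "(cmod (c *\<^sub>R z))\<^sup>2 + 1 / 2 \<le> r\<^sup>2"
        unfolding cr using r m1 by (simp add: field_simps)
      have "a * ((cmod (c *\<^sub>R z))\<^sup>2 + 1 / 2) \<le> a * r\<^sup>2"
        using gap a by (intro mult_left_mono) auto
      then have E: "?E z \<le> exp (- a / 2) * ?E (c *\<^sub>R z)"
        by (simp flip: exp_add add: r_def algebra_simps)
      obtain w where w: "cmod (w - z) \<le> 2 / (1 + r)"
        and max: "\<And>v. cmod (v - z) \<le> 2 / (1 + r) \<Longrightarrow> cmod (deriv F v) \<le> cmod (deriv F w)"
        using cmod_attains_max_cball[OF cF(2), of "2 / (1 + r)" z] r by auto
      have "(1 - c) * r \<le> 1 / (m + 1) * r"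
      proof (rule mult_right_mono)
        have "1 - c \<le> 1 - c\<^sup>2"
          using c(1,2) mult_left_le[of c c] by (simp add: power2_eq_square)
        also have "\<dots> = 1 / (m + 1)" using c m1 by (simp add: field_simps)
        finally show "1 - c \<le> 1 / (m + 1)" .
      qed (use r in auto)
      also have "\<dots> \<le> 2 / (1 + r)"
      proof -
        have "r \<le> r\<^sup>2" using r1 by (simp add: power2_eq_square)
        then have "r * (1 + r) \<le> 2 * (m + 1)" using r by (simp add: power2_eq_square algebra_simps)
        then show ?thesis using r m1 by (simp add: field_simps)
      qed
      finally have move: "(1 - c) * r \<le> 2 / (1 + r)" .
      have dist: "cmod (c *\<^sub>R z - z) \<le> 2 / (1 + r)"
      proof -
        have "c *\<^sub>R z - z = (c - 1) *\<^sub>R z" by (simp add: algebra_simps)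
        then have "cmod (c *\<^sub>R z - z) = (1 - c) * r" using c by (simp add: r_def)
        then show ?thesis using move by simp
      qed
      have "cmod (F z - F (c *\<^sub>R z)) \<le> cmod (deriv F w) * cmod (z - c *\<^sub>R z)"
      proof (rule field_differentiable_bound[where S = "cball z (2 / (1 + r))" and f' = "deriv F"])
        show "(F has_field_derivative deriv F v) (at v within cball z (2 / (1 + r)))" for v
          using F by (meson UNIV_I holomorphic_derivI open_UNIV)
        show "cmod (deriv F v) \<le> cmod (deriv F w)" if "v \<in> cball z (2 / (1 + r))" for v
          using max that by (simp add: dist_norm norm_minus_commute)
        show "c *\<^sub>R z \<in> cball z (2 / (1 + r))"
          using dist by (simp add: dist_norm norm_minus_commute)
      qed (use r in auto)
      also have "\<dots> \<le> cmod (deriv F w) * (2 / (1 + r))"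
        using dist by (intro mult_left_mono) (auto simp: norm_minus_commute)
      finally have "cmod (F z) \<le> cmod (F (c *\<^sub>R z)) + cmod (deriv F w) * (2 / (1 + r))"
        using norm_triangle_ineq2[of "F z" "F (c *\<^sub>R z)"] by linarith
      then have "cmod (F z) powr q \<le> (cmod (F (c *\<^sub>R z)) + cmod (deriv F w) * (2 / (1 + r))) powr q"
        using q by (intro powr_mono2) auto
      also have "\<dots> \<le> (1 + \<epsilon>) powr q * cmod (F (c *\<^sub>R z)) powr q
          + (1 + 1 / \<epsilon>) powr q * (cmod (deriv F w) * (2 / (1 + r))) powr q"
        using q eps r by (intro powr_add_le_weighted) auto
      also have "\<dots> = exp (a / 8) * cmod (F (c *\<^sub>R z)) powr q
          + L * (cmod (deriv F w) powr q / (1 + r) powr q)"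
        using r unfolding eps_q by (simp add: powr_mult powr_divide L_def)
      finally have "cmod (F z) powr q * ?E z \<le> (exp (a / 8) * cmod (F (c *\<^sub>R z)) powr q
          + L * (cmod (deriv F w) powr q / (1 + r) powr q)) * ?E z"
        by (rule mult_right_mono) simp
      also have "\<dots> \<le> exp (a / 8) * cmod (F (c *\<^sub>R z)) powr q * (exp (- a / 2) * ?E (c *\<^sub>R z))
          + L * (cmod (deriv F w) powr q * ?V z)"
        unfolding distrib_right using E by (intro add_mono mult_left_mono) (auto simp: r_def)
      finally have "ennreal (cmod (F z) powr q * ?E z) \<le>
          ennreal (exp (a / 8) * exp (- a / 2) * (cmod (F (c *\<^sub>R z)) powr q * ?E (c *\<^sub>R z))
          + L * (cmod (deriv F w) powr q * ?V z))"
        by (intro ennreal_leI) (simp add: mult_ac)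
      also have "\<dots> = ennreal (exp (a / 8) * exp (- a / 2)) * ennreal (cmod (F (c *\<^sub>R z)) powr q * ?E (c *\<^sub>R z))
          + ennreal L * ennreal (cmod (deriv F w) powr q * ?V z)"
        using L by (intro aux) auto
      also have "\<dots> \<le> ennreal (exp (a / 8) * exp (- a / 2)) * ennreal (cmod (F (c *\<^sub>R z)) powr q * ?E (c *\<^sub>R z))
          + ennreal L * (ennreal C * ?A z)"
        using av[OF dF, of w z] w by (intro add_left_mono mult_left_mono) (auto simp: r_def)
      finally show ?thesis
        using True in_shell L C by (simp add: ennreal_mult mult_ac)
    qed simp
    have [measurable]: "(\<lambda>z. ?h (c *\<^sub>R z)) \<in> borel_measurable borel"
      using meas_h by (rule measurable_compose[rotated]) simp
    have "(\<integral>\<^sup>+z. ennreal (cmod (F z) powr q * ?E z) * indicator (shell (Suc k)) z \<partial>lborel)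
       \<le> (\<integral>\<^sup>+z. ennreal (exp (a / 8) * exp (- a / 2)) * ?h (c *\<^sub>R z)
          + ennreal (L * C) * (?A z * indicator (shell (Suc k)) z) \<partial>lborel)"
      by (intro nn_integral_mono pt)
    also have "\<dots> = ennreal (exp (a / 8) * exp (- a / 2)) * (\<integral>\<^sup>+z. ?h (c *\<^sub>R z) \<partial>lborel)
        + ennreal (L * C) * (\<integral>\<^sup>+z. ?A z * indicator (shell (Suc k)) z \<partial>lborel)"
      by (subst nn_integral_add) (auto simp: nn_integral_cmult)
    also have "(\<integral>\<^sup>+z. ?h (c *\<^sub>R z) \<partial>lborel) = ennreal (1 / c\<^sup>2) * (\<integral>\<^sup>+z. ?h z \<partial>lborel)"
      unfolding nn_integral_lborel_scaleR[OF meas_h c(1)[THEN less_imp_neq, symmetric]]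
        mult.assoc[symmetric] using c(1) by (subst ennreal_mult[symmetric]) auto
    also have "ennreal (exp (a / 8) * exp (- a / 2)) * (ennreal (1 / c\<^sup>2) * (\<integral>\<^sup>+z. ?h z \<partial>lborel))
       \<le> ennreal (exp (- a / 4)) * (\<integral>\<^sup>+z. ?h z \<partial>lborel)"
    proof -
      have "1 / c\<^sup>2 = 1 + 1 / m" using c m1 by (simp add: field_simps)
      also have "\<dots> \<le> exp (1 / m)" by (rule exp_ge_add_one_self)
      also have "\<dots> \<le> exp (a / 8)" using m8 by simp
      finally have "exp (a / 8) * exp (- a / 2) * (1 / c\<^sup>2) \<le> exp (a / 8) * exp (- a / 2) * exp (a / 8)"
        by (intro mult_left_mono) auto
      also have "\<dots> = exp (- a / 4)" by (simp flip: exp_add)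
      finally have "ennreal (exp (a / 8) * exp (- a / 2)) * ennreal (1 / c\<^sup>2) \<le> ennreal (exp (- a / 4))"
        by (subst ennreal_mult[symmetric]) (auto intro: ennreal_leI)
      then show ?thesis by (subst mult.assoc[symmetric]) (rule mult_right_mono, auto)
    qed
    finally show ?thesis by (simp add: add_right_mono)
  qed
  show ?thesis
    by (rule that[of "exp (- a / 4)" "L * C" k0]) (use a L C step in auto)
qed

lemma shell_cover: "z \<in> shell (nat \<lfloor>(cmod z)\<^sup>2\<rfloor>)"
  by (simp add: shell_def)

lemma shell_disjoint: "disjoint_family shell"
proof -
  have "j = k" if "z \<in> shell j" "z \<in> shell k" for j k z
  proof -
    have "real j < real k + 1" "real k < real j + 1" using that by (auto simp: shell_def)
    then show ?thesis by linarith
  qed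
  then show ?thesis by (auto simp: disjoint_family_on_def)
qed

lemma nn_integral_shells:
  assumes [measurable]: "h \<in> borel_measurable borel"
  shows "(\<integral>\<^sup>+z. h z \<partial>lborel) = (\<Sum>k. \<integral>\<^sup>+z. h z * indicator (shell k) z \<partial>lborel)"
proof -
  have "(\<integral>\<^sup>+z. h z \<partial>lborel) = (\<integral>\<^sup>+z. (\<Sum>k. h z * indicator (shell k) z) \<partial>lborel)"
    by (intro nn_integral_cong) (subst suminf_cmult_indicator[OF shell_disjoint shell_cover], rule refl)
  also have "\<dots> = (\<Sum>k. \<integral>\<^sup>+z. h z * indicator (shell k) z \<partial>lborel)"
    by (intro nn_integral_suminf) measurable
  finally show ?thesis .
qed

text \<open>The bound is proved for partial sums by induction. Absorbing
  \<open>\<theta> * suminf I\<close> into the left side would require \<open>suminf I\<close> to be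
  finite beforehand. The constant \<open>1 / (1 - \<theta>)\<close> is the fixed point of
  \<open>D = 1 + \<theta> * D\<close>.\<close>

lemma suminf_le_of_contraction:
  fixes I J :: "nat \<Rightarrow> ennreal"
  assumes \<theta>: "0 < \<theta>" "\<theta> < 1" and step: "\<And>k. k0 \<le> k \<Longrightarrow> I (Suc k) \<le> ennreal \<theta> * I k + J (Suc k)"
  shows "suminf I \<le> ennreal (1 / (1 - \<theta>)) * ((\<Sum>k\<le>k0. I k) + suminf J)"
proof -
  define D where "D = 1 / (1 - \<theta>)"
  have D: "1 \<le> D" "1 + \<theta> * D = D" using \<theta> by (auto simp: D_def field_simps)
  let ?B = "(\<Sum>k\<le>k0. I k) + suminf J"
  have part: "(\<Sum>k\<le>k0 + n. I k) \<le> ennreal D * ?B" for n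
  proof (induction n)
    case 0
    have "(\<Sum>k\<le>k0. I k) \<le> 1 * ?B" by (simp add: add_increasing2)
    also have "\<dots> \<le> ennreal D * ?B"
      using ennreal_leI[OF D(1)] by (intro mult_right_mono) auto
    finally show ?case by simp
  next
    case (Suc n)
    have J: "(\<Sum>k = k0..k0 + n. J (Suc k)) \<le> suminf J"
    proof -
      have "(\<Sum>k = k0..k0 + n. J (Suc k)) = sum J (Suc ` {k0..k0 + n})"
        by (simp add: sum.reindex o_def del: image_Suc_atLeastAtMost)
      also have "\<dots> \<le> suminf J" by (intro sum_le_suminf) auto
      finally show ?thesis .
    qed
    have "{..k0 + Suc n} = {..k0} \<union> Suc ` {k0..k0 + n}"
      by auto
    moreover have disj: "{..k0} \<inter> Suc ` {k0..k0 + n} = {}" by auto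
    ultimately have "(\<Sum>k\<le>k0 + Suc n. I k) = (\<Sum>k\<le>k0. I k) + (\<Sum>k = k0..k0 + n. I (Suc k))"
      by (simp add: sum.union_disjoint[OF _ _ disj] sum.reindex o_def del: image_Suc_atLeastAtMost)
    also have "(\<Sum>k = k0..k0 + n. I (Suc k)) \<le> (\<Sum>k = k0..k0 + n. ennreal \<theta> * I k + J (Suc k))"
      by (intro sum_mono step) auto
    also have "\<dots> = ennreal \<theta> * (\<Sum>k = k0..k0 + n. I k) + (\<Sum>k = k0..k0 + n. J (Suc k))"
      by (simp add: sum.distrib sum_distrib_left)
    also have "\<dots> \<le> ennreal \<theta> * (\<Sum>k\<le>k0 + n. I k) + suminf J"
      using J by (intro add_mono mult_left_mono sum_mono2) auto
    also have "\<dots> \<le> ennreal \<theta> * (ennreal D * ?B) + suminf J"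
      using Suc.IH by (intro add_right_mono mult_left_mono) auto
    finally have "(\<Sum>k\<le>k0 + Suc n. I k) \<le> (\<Sum>k\<le>k0. I k) + (ennreal \<theta> * (ennreal D * ?B) + suminf J)"
      by (simp add: add_left_mono)
    also have "\<dots> = (ennreal 1 + ennreal (\<theta> * D)) * ?B"
      using \<theta> D by (simp add: ennreal_mult distrib_right algebra_simps)
    also have "ennreal 1 + ennreal (\<theta> * D) = ennreal D"
      using \<theta> D by (subst ennreal_plus[symmetric]) auto
    finally show ?case .
  qed
  have "suminf I \<le> ennreal D * ?B"
  proof (rule suminf_le_const)
    fix n
    have "sum I {..<n} \<le> (\<Sum>k\<le>k0 + n. I k)" by (intro sum_mono2) auto
    also note part
    finally show "sum I {..<n} \<le> ennreal D * ?B" .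
  qed auto
  then show ?thesis by (simp add: D_def)
qed

text \<open>This treats the finitely many shells before the contraction sets in. On a bounded disc
  \<open>F\<close> is recovered from \<open>F 0\<close> and the maximum of \<open>F'\<close>, and
  that maximum is controlled by the integral over a unit disc about the point where it is attained.
  The constant depends on \<open>k\<close>.\<close>

lemma nn_integral_shell_le:
  fixes q a :: real
  assumes q: "0 < q" and a: "0 < a"
  obtains C where "0 < C" and "\<And>F j. F holomorphic_on UNIV \<Longrightarrow> j \<le> k \<Longrightarrow>
     (\<integral>\<^sup>+z. ennreal (cmod (F z) powr q * exp (- a * (cmod z)\<^sup>2)) * indicator (shell j) z \<partial>lborel)
     \<le> ennreal C * (ennreal (cmod (F 0) powr q) + (\<integral>\<^sup>+z. ennreal (cmod (deriv F z) powr q *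
           (exp (- a * (cmod z)\<^sup>2) / (1 + cmod z) powr q)) \<partial>lborel))"
proof -
  let ?E = "\<lambda>z. exp (- a * (cmod z)\<^sup>2)"
  let ?V = "\<lambda>z. exp (- a * (cmod z)\<^sup>2) / (1 + cmod z) powr q"
  obtain C0 where C0: "0 < C0" and loc: "\<And>F z \<rho>. F holomorphic_on UNIV \<Longrightarrow> 0 < \<rho> \<Longrightarrow>
     ennreal (cmod (F z) powr q * \<rho>\<^sup>2) \<le>
       ennreal C0 * (\<integral>\<^sup>+w. ennreal (cmod (F w) powr q) * indicator (ball z \<rho>) w \<partial>lborel)"
    using powr_le_nn_integral_ball[OF q] by blast
  define R where "R = real k + 1"
  have R: "1 \<le> R" by (simp add: R_def)
  \<comment> \<open>Compensates for the Gaussian and the denominator on every disc of radius 1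
    centred in the disc of radius \<open>R\<close>: there \<open>1 \<le> M * ?V u\<close>.\<close>
  define M where "M = exp (a * (R + 1)\<^sup>2) * (R + 2) powr q"
  have M: "0 < M" using R by (simp add: M_def)
  define A where "A = pi * (R + 1)\<^sup>2"
  have A: "0 < A" using R by (simp add: A_def)
  define c2 where "c2 = 2 powr q * (1 + R powr q * (C0 * M))"
  have c2: "0 < c2" using C0 M R by (simp add: c2_def add_pos_nonneg)
  define C where "C = A * c2"
  have C: "0 < C" using A c2 by (simp add: C_def)
  have "(\<integral>\<^sup>+z. ennreal (cmod (F z) powr q * ?E z) * indicator (shell j) z \<partial>lborel)
     \<le> ennreal C * (ennreal (cmod (F 0) powr q) + (\<integral>\<^sup>+z. ennreal (cmod (deriv F z) powr q * ?V z) \<partial>lborel))"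
    if F: "F holomorphic_on UNIV" and j: "j \<le> k" for F j
  proof -
    let ?H = "\<integral>\<^sup>+z. ennreal (cmod (deriv F z) powr q * ?V z) \<partial>lborel"
    have dF: "deriv F holomorphic_on UNIV" using F by (simp add: holomorphic_deriv)
    have cdF: "continuous_on UNIV (deriv F)" using dF by (rule holomorphic_on_imp_continuous_on)
    have [measurable]: "deriv F \<in> borel_measurable borel"
      using cdF by (rule borel_measurable_continuous_onI)
    obtain w where w: "cmod w \<le> R" and max: "\<And>v. cmod v \<le> R \<Longrightarrow> cmod (deriv F v) \<le> cmod (deriv F w)"
      using cmod_attains_max_cball[OF cdF, of R 0] R by auto
    have "ennreal (cmod (deriv F w) powr q) \<le>
        ennreal C0 * (\<integral>\<^sup>+u. ennreal (cmod (deriv F u) powr q) * indicator (ball w 1) u \<partial>lborel)"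
      using loc[OF dF, of 1 w] by simp
    also have "\<dots> \<le> ennreal C0 * (\<integral>\<^sup>+u. ennreal M * ennreal (cmod (deriv F u) powr q * ?V u) \<partial>lborel)"
    proof (intro mult_left_mono nn_integral_mono)
      fix u
      show "ennreal (cmod (deriv F u) powr q) * indicator (ball w 1) u
          \<le> ennreal M * ennreal (cmod (deriv F u) powr q * ?V u)"
      proof (cases "u \<in> ball w 1")
        case True
        then have u: "cmod u \<le> R + 1"
          using w norm_triangle_ineq[of "u - w" w] by (simp add: dist_norm norm_minus_commute)
        have "a * (cmod u)\<^sup>2 \<le> a * (R + 1)\<^sup>2" using u a by (intro mult_left_mono power_mono) auto
        then have 1: "1 \<le> exp (a * (R + 1)\<^sup>2) * ?E u" by (simp flip: exp_add)
        have "(1 + cmod u) powr q \<le> (R + 2) powr q" using u q by (intro powr_mono2) auto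
        then have 2: "1 \<le> (R + 2) powr q / (1 + cmod u) powr q"
          using norm_ge_zero[of u] by (simp add: divide_simps add_nonneg_eq_0_iff)
        have "1 * 1 \<le> (exp (a * (R + 1)\<^sup>2) * ?E u) * ((R + 2) powr q / (1 + cmod u) powr q)"
          using 1 2 by (intro mult_mono) auto
        then have "1 \<le> M * ?V u" by (simp add: M_def mult_ac)
        then have "cmod (deriv F u) powr q * 1 \<le> cmod (deriv F u) powr q * (M * ?V u)"
          by (intro mult_left_mono) auto
        then show ?thesis using True M
          by (subst ennreal_mult[symmetric]) (auto intro!: ennreal_leI simp: mult_ac)
      qed simp
    qed simp
    also have "\<dots> = ennreal (C0 * M) * ?H"
      using C0 M by (subst nn_integral_cmult) (auto simp: ennreal_mult mult.assoc)
    finally have w_le: "ennreal (cmod (deriv F w) powr q) \<le> ennreal (C0 * M) * ?H" .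
    define X where "X = 2 powr q * cmod (F 0) powr q + 2 powr q * (R * cmod (deriv F w)) powr q"
    have X: "0 \<le> X" by (simp add: X_def)
    have "ennreal X = ennreal (2 powr q) * ennreal (cmod (F 0) powr q)
        + ennreal (2 powr q * R powr q) * ennreal (cmod (deriv F w) powr q)"
      using R by (simp add: X_def powr_mult ennreal_mult mult.assoc)
    also have "\<dots> \<le> ennreal (2 powr q) * ennreal (cmod (F 0) powr q)
        + ennreal (2 powr q * R powr q) * (ennreal (C0 * M) * ?H)"
      using w_le by (intro add_left_mono mult_left_mono) auto
    also have "\<dots> = ennreal (2 powr q) * ennreal (cmod (F 0) powr q)
        + ennreal (2 powr q * (R powr q * (C0 * M))) * ?H"
      using C0 M by (simp add: ennreal_mult mult.assoc)
    also have "\<dots> \<le> ennreal (2 powr q * (1 + R powr q * (C0 * M))) * ennreal (cmod (F 0) powr q)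
        + ennreal (2 powr q * (1 + R powr q * (C0 * M))) * ?H"
      using C0 M by (intro add_mono mult_right_mono ennreal_leI) (auto simp: distrib_left)
    finally have X_le: "ennreal X \<le> ennreal c2 * (ennreal (cmod (F 0) powr q) + ?H)"
      by (simp only: c2_def distrib_left)
    have "(\<integral>\<^sup>+z. ennreal (cmod (F z) powr q * ?E z) * indicator (shell j) z \<partial>lborel)
        \<le> (\<integral>\<^sup>+z. ennreal X * indicator (ball (0::complex) (R + 1)) z \<partial>lborel)"
    proof (intro nn_integral_mono)
      fix z
      show "ennreal (cmod (F z) powr q * ?E z) * indicator (shell j) z \<le> ennreal X * indicator (ball 0 (R + 1)) z"
      proof (cases "z \<in> shell j")
        case True
        then have "(cmod z)\<^sup>2 \<le> R" using j by (simp add: shell_def R_def)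
        also have "R \<le> R\<^sup>2" using R by (simp add: power2_eq_square)
        finally have zR: "cmod z \<le> R" by (rule power2_le_imp_le) (use R in auto)
        have "cmod (F z - F 0) \<le> cmod (deriv F w) * cmod (z - 0)"
        proof (rule field_differentiable_bound[where S = "cball 0 R" and f' = "deriv F"])
          show "(F has_field_derivative deriv F v) (at v within cball 0 R)" for v
            using F by (meson UNIV_I holomorphic_derivI open_UNIV)
        qed (use zR R max in auto)
        also have "\<dots> \<le> R * cmod (deriv F w)"
          using zR by (simp add: mult.commute mult_right_mono)
        finally have "cmod (F z) \<le> cmod (F 0) + R * cmod (deriv F w)"
          using norm_triangle_ineq2[of "F z" "F 0"] by linarith
        then have "cmod (F z) powr q \<le> (cmod (F 0) + R * cmod (deriv F w)) powr q"
          using q by (intro powr_mono2) auto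
        also have "\<dots> \<le> X"
          using powr_add_le_weighted[of "cmod (F 0)" "R * cmod (deriv F w)" 1 q] q R by (simp add: X_def)
        finally have "cmod (F z) powr q * ?E z \<le> X * 1"
          using a X by (intro mult_mono) auto
        then show ?thesis using True zR by (auto intro: ennreal_leI)
      qed simp
    qed
    also have "\<dots> = ennreal A * ennreal X"
      using R by (simp add: nn_integral_cmult_indicator emeasure_lborel_ball_complex A_def mult.commute)
    also have "\<dots> \<le> ennreal A * (ennreal c2 * (ennreal (cmod (F 0) powr q) + ?H))"
      using X_le by (intro mult_left_mono) auto
    also have "\<dots> = ennreal C * (ennreal (cmod (F 0) powr q) + ?H)"
      using A c2 by (simp only: C_def ennreal_mult less_imp_le mult.assoc)
    finally show ?thesis .
  qed
  with C that show ?thesis by blast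
qed

text \<open>Both sides may be infinite. Hence a finite right side proves that \<open>F\<close> lies
  in the Fock space and bounds its norm at the same time.\<close>

lemma nn_integral_le_deriv:
  fixes q a :: real
  assumes q: "0 < q" and a: "0 < a"
  obtains C where "0 < C" and "\<And>F. F holomorphic_on UNIV \<Longrightarrow>
     (\<integral>\<^sup>+z. ennreal (cmod (F z) powr q * exp (- a * (cmod z)\<^sup>2)) \<partial>lborel)
     \<le> ennreal C * (ennreal (cmod (F 0) powr q) +
         (\<integral>\<^sup>+z. ennreal ((cmod (deriv F z) / (1 + cmod z)) powr q * exp (- a * (cmod z)\<^sup>2)) \<partial>lborel))"
proof -
  let ?E = "\<lambda>z. exp (- a * (cmod z)\<^sup>2)"
  let ?V = "\<lambda>z. exp (- a * (cmod z)\<^sup>2) / (1 + cmod z) powr q"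
  obtain \<theta> K k0 where th: "0 < \<theta>" "\<theta> < 1" and K: "0 < K" and step: "\<And>F k. F holomorphic_on UNIV \<Longrightarrow> k0 \<le> k \<Longrightarrow>
     (\<integral>\<^sup>+z. ennreal (cmod (F z) powr q * ?E z) * indicator (shell (Suc k)) z \<partial>lborel)
     \<le> ennreal \<theta> * (\<integral>\<^sup>+z. ennreal (cmod (F z) powr q * ?E z) * indicator (shell k) z \<partial>lborel)
       + ennreal K * (\<integral>\<^sup>+z. disc_average (\<lambda>u. ennreal (cmod (deriv F u) powr q * ?V u)) z * indicator (shell (Suc k)) z \<partial>lborel)"
    by (rule nn_integral_shell_step[OF q a]) blast
  obtain C where C: "0 < C" and low: "\<And>F j. F holomorphic_on UNIV \<Longrightarrow> j \<le> k0 \<Longrightarrow>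
     (\<integral>\<^sup>+z. ennreal (cmod (F z) powr q * ?E z) * indicator (shell j) z \<partial>lborel)
     \<le> ennreal C * (ennreal (cmod (F 0) powr q) + (\<integral>\<^sup>+z. ennreal (cmod (deriv F z) powr q * ?V z) \<partial>lborel))"
    by (rule nn_integral_shell_le[OF q a, of k0]) blast
  define D where "D = 1 / (1 - \<theta>)"
  have D: "0 < D" using th by (simp add: D_def)
  define C' where "C' = D * (real (Suc k0) * C + K * (2304 * pi))"
  have C': "0 < C'" using D C K by (simp add: C'_def add_pos_pos)
  have "(\<integral>\<^sup>+z. ennreal (cmod (F z) powr q * ?E z) \<partial>lborel)
     \<le> ennreal C' * (ennreal (cmod (F 0) powr q) +
         (\<integral>\<^sup>+z. ennreal ((cmod (deriv F z) / (1 + cmod z)) powr q * ?E z) \<partial>lborel))"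
    if F: "F holomorphic_on UNIV" for F
  proof -
    have dF: "deriv F holomorphic_on UNIV" using F by (simp add: holomorphic_deriv)
    have [measurable]: "F \<in> borel_measurable borel" "deriv F \<in> borel_measurable borel"
      using F dF by (auto intro: borel_measurable_continuous_onI holomorphic_on_imp_continuous_on)
    let ?h = "\<lambda>u. ennreal (cmod (deriv F u) powr q * ?V u)"
    let ?H = "\<integral>\<^sup>+z. ?h z \<partial>lborel"
    let ?I = "\<lambda>k. \<integral>\<^sup>+z. ennreal (cmod (F z) powr q * ?E z) * indicator (shell k) z \<partial>lborel"
    let ?J = "\<lambda>k. ennreal K * (\<integral>\<^sup>+z. disc_average ?h z * indicator (shell k) z \<partial>lborel)"
    let ?X = "ennreal (cmod (F 0) powr q) + ?H"
    have "(\<integral>\<^sup>+z. ennreal (cmod (F z) powr q * ?E z) \<partial>lborel) = suminf ?I"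
      by (rule nn_integral_shells) measurable
    also have "\<dots> \<le> ennreal D * ((\<Sum>k\<le>k0. ?I k) + suminf ?J)"
      unfolding D_def by (rule suminf_le_of_contraction[OF th, where I = ?I and J = ?J], rule step[OF F])
    also have "suminf ?J = ennreal K * (\<integral>\<^sup>+z. disc_average ?h z \<partial>lborel)"
      by (subst nn_integral_shells) auto
    also have "\<dots> \<le> ennreal K * (ennreal (2304 * pi) * ?X)"
      by (intro mult_left_mono order_trans[OF nn_integral_disc_average_le]) (auto intro!: mult_left_mono)
    also have "(\<Sum>k\<le>k0. ?I k) \<le> (\<Sum>k\<le>k0. ennreal C * ?X)"
      by (intro sum_mono low F) auto
    also have "\<dots> = ennreal (real (Suc k0)) * (ennreal C * ?X)"
      by (simp flip: ennreal_of_nat_eq_real_of_nat)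
    also have "ennreal D * (ennreal (real (Suc k0)) * (ennreal C * ?X) + ennreal K * (ennreal (2304 * pi) * ?X))
       = ennreal C' * ?X"
    proof -
      have "ennreal C' = ennreal D * (ennreal (real (Suc k0)) * ennreal C + ennreal K * ennreal (2304 * pi))"
        using D C K unfolding C'_def by (simp flip: ennreal_mult ennreal_plus)
      then show ?thesis by (simp only: distrib_right distrib_left ac_simps)
    qed
    also have "?H = (\<integral>\<^sup>+z. ennreal ((cmod (deriv F z) / (1 + cmod z)) powr q * ?E z) \<partial>lborel)"
      by (intro nn_integral_cong) (simp add: powr_divide)
    finally show ?thesis by (simp add: mult_left_mono add_right_mono)
  qed
  with C' that show ?thesis by blast
qed

section \<open>The case of the supremum norm\<close>

text \<open>Cauchy's estimate on the disc of radius \<open>1 / (1 + cmod z)\<close>; the reciprocal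
  Gaussian grows there by at most the factor \<open>exp (9 * a)\<close>.\<close>

lemma deriv_growth_of_growth:
  assumes F: "F holomorphic_on UNIV" and a: "0 < a"
    and B: "\<And>z. cmod (F z) * exp (- a * (cmod z)\<^sup>2) \<le> B"
  shows "cmod (deriv F z) / (1 + cmod z) * exp (- a * (cmod z)\<^sup>2) \<le> exp (9 * a) * B"
proof -
  define r where "r = 1 / (1 + cmod z)"
  have r: "0 < r" by (simp add: r_def add_pos_nonneg)
  have B0: "0 \<le> B" using B[of 0] by (rule order_trans[rotated]) simp
  have "cmod (F w) \<le> exp (9 * a) * B * exp (a * (cmod z)\<^sup>2)" if w: "cmod (w - z) \<le> r" for w
  proof -
    have "r < 3 / (1 + cmod z)" unfolding r_def
      using norm_ge_zero[of z] by (intro divide_strict_right_mono) linarith+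
    then have d: "cmod (z - w) < 3 / (1 + cmod z)" using w by (simp add: norm_minus_commute)
    have "a * (cmod w)\<^sup>2 \<le> a * ((cmod z)\<^sup>2 + 9)"
      using norm_compare_disc(3)[OF d] a by (intro mult_left_mono) auto
    then have e: "exp (a * (cmod w)\<^sup>2) \<le> exp (9 * a) * exp (a * (cmod z)\<^sup>2)"
      by (simp flip: exp_add add: algebra_simps)
    have "cmod (F w) = cmod (F w) * exp (- a * (cmod w)\<^sup>2) * exp (a * (cmod w)\<^sup>2)"
      by (simp flip: exp_add add: mult.assoc)
    also have "\<dots> \<le> B * (exp (9 * a) * exp (a * (cmod z)\<^sup>2))"
      using B e B0 by (intro mult_mono) auto
    finally show ?thesis by (simp add: mult_ac)
  qed
  then have "cmod (deriv F z) \<le> exp (9 * a) * B * exp (a * (cmod z)\<^sup>2) / r"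
    by (rule norm_deriv_le[OF F r])
  then have "cmod (deriv F z) / (1 + cmod z) \<le> exp (9 * a) * B * exp (a * (cmod z)\<^sup>2)"
    by (simp add: r_def pos_divide_le_eq add_pos_nonneg)
  then have "cmod (deriv F z) / (1 + cmod z) * exp (- a * (cmod z)\<^sup>2)
      \<le> exp (9 * a) * B * exp (a * (cmod z)\<^sup>2) * exp (- a * (cmod z)\<^sup>2)"
    by (rule mult_right_mono) simp
  then show ?thesis by (simp flip: exp_add add: mult.assoc)
qed

text \<open>Along a ray, \<open>(1 + s) * exp (a * s\<^sup>2)\<close> is dominated by the derivative of
  \<open>exp (a * s\<^sup>2) / a + 2 * exp a * s\<close>.\<close>

lemma growth_of_deriv_growth:
  assumes F: "F holomorphic_on UNIV" and a: "0 < a" and B0: "0 \<le> B"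
    and B: "\<And>z. cmod (deriv F z) / (1 + cmod z) * exp (- a * (cmod z)\<^sup>2) \<le> B"
  shows "cmod (F z) * exp (- a * (cmod z)\<^sup>2) \<le> cmod (F 0) + B * (1 / a + 2 * exp a * (1 + 1 / a))"
proof (cases "z = 0")
  case True
  then show ?thesis using a B0 by simp
next
  case False
  define r where "r = cmod z"
  have r: "0 < r" using False by (simp add: r_def)
  define u where "u = z / of_real r"
  have u: "cmod u = 1" "z = of_real r * u" using r by (simp_all add: u_def norm_divide r_def)
  have hasF: "(F has_field_derivative deriv F v) (at v)" for v
    using F by (meson UNIV_I holomorphic_derivI open_UNIV)
  define \<psi> where "\<psi> = (\<lambda>s. B * (exp (a * s\<^sup>2) / a + 2 * exp a * s))"
  have dF: "((\<lambda>s. F (of_real s * u)) has_vector_derivative u * deriv F (of_real s * u)) (at s)" for s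
  proof -
    have "((\<lambda>s. of_real s * u) has_vector_derivative u) (at s)"
      by (auto intro!: derivative_eq_intros)
    from field_vector_diff_chain_at[OF this hasF] show ?thesis by (simp add: o_def)
  qed
  have dpsi: "(\<psi> has_vector_derivative B * (2 * s * exp (a * s\<^sup>2) + 2 * exp a)) (at s)" for s
    unfolding \<psi>_def has_real_derivative_iff_has_vector_derivative[symmetric] using a
    by (auto intro!: derivative_eq_intros simp: field_simps)
  have bound: "cmod (u * deriv F (of_real s * u)) \<le> B * (2 * s * exp (a * s\<^sup>2) + 2 * exp a)" if s: "0 < s" for s
  proof -
    have ns: "cmod (of_real s * u) = s" using u s by (simp add: norm_mult)
    have "cmod (deriv F (of_real s * u)) / (1 + s) * exp (- a * s\<^sup>2) * ((1 + s) * exp (a * s\<^sup>2))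
        \<le> B * ((1 + s) * exp (a * s\<^sup>2))"
      using B[of "of_real s * u"] s unfolding ns by (intro mult_right_mono) auto
    moreover have "x / (1 + s) * exp (- a * s\<^sup>2) * ((1 + s) * exp (a * s\<^sup>2)) = x" for x
    proof -
      have "x / (1 + s) * exp (- a * s\<^sup>2) * ((1 + s) * exp (a * s\<^sup>2))
          = x / (1 + s) * (1 + s) * (exp (- a * s\<^sup>2) * exp (a * s\<^sup>2))" by simp
      also have "exp (- a * s\<^sup>2) * exp (a * s\<^sup>2) = 1" by (simp flip: exp_add)
      finally show ?thesis using s by simp
    qed
    ultimately have "cmod (deriv F (of_real s * u)) \<le> B * ((1 + s) * exp (a * s\<^sup>2))" by simp
    also have "\<dots> \<le> B * (2 * s * exp (a * s\<^sup>2) + 2 * exp a)"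
    proof (intro mult_left_mono B0)
      show "(1 + s) * exp (a * s\<^sup>2) \<le> 2 * s * exp (a * s\<^sup>2) + 2 * exp a"
      proof (cases "s \<le> 1")
        case True
        then have "a * s\<^sup>2 \<le> a * 1" using a s by (intro mult_left_mono) (auto simp: power_le_one)
        then have "(1 + s) * exp (a * s\<^sup>2) \<le> 2 * exp a" using True s by (intro mult_mono) auto
        moreover have "0 \<le> 2 * s * exp (a * s\<^sup>2)" using s by simp
        ultimately show ?thesis by linarith
      next
        case False
        then have "(1 + s) * exp (a * s\<^sup>2) \<le> 2 * s * exp (a * s\<^sup>2)" by (intro mult_right_mono) auto
        then show ?thesis by (simp add: add_increasing2)
      qed
    qed
    finally show ?thesis using u by (simp add: norm_mult)
  qed
  have "cmod (F (of_real r * u) - F (of_real 0 * u)) \<le> \<psi> r - \<psi> 0"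
  proof (rule differentiable_bound_general[OF r])
    show "continuous_on {0..r} (\<lambda>s. F (of_real s * u))"
      using dF by (meson continuous_at_imp_continuous_on has_vector_derivative_continuous)
    show "continuous_on {0..r} \<psi>" unfolding \<psi>_def using a by (intro continuous_intros) auto
  qed (use dF dpsi bound in auto)
  then have "cmod (F z - F 0) \<le> \<psi> r"
    using a u divide_nonneg_pos[OF B0 a] unfolding \<psi>_def by (simp add: right_diff_distrib)
  then have Fz: "cmod (F z) \<le> cmod (F 0) + \<psi> r"
    using norm_triangle_ineq2[of "F z" "F 0"] by linarith
  have E: "exp (- a * r\<^sup>2) \<le> 1" using a by simp
  have "r * exp (- a * r\<^sup>2) \<le> 1 + 1 / a"
  proof -
    have "a * r\<^sup>2 \<le> exp (a * r\<^sup>2)" using exp_ge_add_one_self[of "a * r\<^sup>2"] by linarith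
    then have "r\<^sup>2 * exp (- a * r\<^sup>2) \<le> 1 / a" using a by (simp add: exp_minus field_simps)
    moreover have "r \<le> 1 + r\<^sup>2" using sum_power2_ge_zero[of "r - 1 / 2" 0]
      by (simp add: power2_eq_square algebra_simps)
    then have "r * exp (- a * r\<^sup>2) \<le> (1 + r\<^sup>2) * exp (- a * r\<^sup>2)" by (rule mult_right_mono) simp
    ultimately show ?thesis using E unfolding distrib_right by linarith
  qed
  then have "2 * exp a * (r * exp (- a * r\<^sup>2)) \<le> 2 * exp a * (1 + 1 / a)" by (intro mult_left_mono) auto
  then have "2 * exp a * r * exp (- a * r\<^sup>2) \<le> 2 * exp a * (1 + 1 / a)" by (simp only: mult.assoc)
  moreover have "exp (a * r\<^sup>2) / a * exp (- a * r\<^sup>2) = 1 / a" by (simp flip: exp_add)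
  ultimately have "(exp (a * r\<^sup>2) / a + 2 * exp a * r) * exp (- a * r\<^sup>2) \<le> 1 / a + 2 * exp a * (1 + 1 / a)"
    unfolding distrib_right by linarith
  then have "\<psi> r * exp (- a * r\<^sup>2) \<le> B * (1 / a + 2 * exp a * (1 + 1 / a))"
    unfolding \<psi>_def mult.assoc using B0 by (intro mult_left_mono)
  moreover have "cmod (F 0) * exp (- a * r\<^sup>2) \<le> cmod (F 0) * 1" using E by (intro mult_left_mono) auto
  moreover have "cmod (F z) * exp (- a * r\<^sup>2) \<le> (cmod (F 0) + \<psi> r) * exp (- a * r\<^sup>2)"
    using Fz by (intro mult_right_mono) auto
  ultimately show ?thesis unfolding r_def[symmetric] distrib_right by linarith
qed

section \<open>Test functions for a weight\<close>

text \<open>The pair consists of the minimum of \<open>\<omega> r / r ^ n\<close> and a minimiser.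
  Large radii are excluded by the rapid growth of the weight, small ones by
  \<open>\<omega> 0 > 0\<close>: at both ends the quotient is at least its value
  \<open>\<omega> 1\<close> at 1. For \<open>n = 0\<close> monotonicity makes 0 a minimiser, and
  this choice is fixed.\<close>

lemma weight_function_contact:
  assumes "weight_function \<omega>"
  obtains b s where "0 < b" "0 \<le> s" "n = 0 \<Longrightarrow> s = 0" "\<omega> s = b * s ^ n" "\<And>r. 0 \<le> r \<Longrightarrow> b * r ^ n \<le> \<omega> r"
proof (cases "n = 0")
  case True
  then show ?thesis using assms that[of "\<omega> 0" 0]
    by (auto simp: weight_function_def mono_on_def)
next
  case False
  have pos: "\<And>r. 0 \<le> r \<Longrightarrow> 0 < \<omega> r" and mono: "\<And>r r'. 0 \<le> r \<Longrightarrow> r \<le> r' \<Longrightarrow> \<omega> r \<le> \<omega> r'"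
    and cont: "continuous_on {0..} \<omega>" and lim: "filterlim (\<lambda>r. \<omega> r / r ^ n) at_top at_top"
    using assms by (auto simp: weight_function_def mono_on_def)
  let ?h = "\<lambda>r. \<omega> r / r ^ n"
  have "eventually (\<lambda>r. \<omega> 1 \<le> ?h r) at_top"
    using lim by (simp add: filterlim_at_top)
  then obtain T where T: "\<And>r. T \<le> r \<Longrightarrow> \<omega> 1 \<le> ?h r"
    by (auto simp: eventually_at_top_linorder)
  define d where "d = min 1 (\<omega> 0 / \<omega> 1)"
  have d: "0 < d" "d \<le> 1" using pos[of 0] pos[of 1] by (auto simp: d_def)
  have small: "\<omega> 1 \<le> ?h r" if "0 < r" "r \<le> d" for r
  proof -
    have "r ^ n \<le> r" using that d False power_decreasing[of 1 n r] by simp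
    then have "r ^ n \<le> \<omega> 0 / \<omega> 1" using that by (simp add: d_def)
    then have "\<omega> 1 * r ^ n \<le> \<omega> 0" using pos[of 1] by (simp add: field_simps)
    also have "\<dots> \<le> \<omega> r" using mono that by simp
    finally show ?thesis using that by (simp add: field_simps)
  qed
  have "continuous_on {d..max 1 T} ?h"
    using d by (intro continuous_intros continuous_on_subset[OF cont]) auto
  then obtain s where s: "s \<in> {d..max 1 T}" and min: "\<And>r. r \<in> {d..max 1 T} \<Longrightarrow> ?h s \<le> ?h r"
    using continuous_attains_inf[of "{d..max 1 T}" ?h] d by fastforce
  have s0: "0 < s" using s d by simp
  have "?h s \<le> \<omega> 1" using min[of 1] d by simp
  then have "?h s \<le> ?h r" if "0 < r" for r
    using small[OF that] T[of r] min[of r] by (cases "r \<in> {d..max 1 T}") force+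
  then have "?h s * r ^ n \<le> \<omega> r" if "0 < r" for r
    using that by (simp only: zero_less_power pos_le_divide_eq)
  then have "?h s * r ^ n \<le> \<omega> r" if "0 \<le> r" for r
    using that pos[of 0] False by (cases "r = 0") (simp_all add: power_0_left less_imp_le)
  then show ?thesis
    using that[of "?h s" s] s0 pos[of s] False by simp
qed

text \<open>The maximum principle for \<open>f w / w ^ k\<close> on an annulus. It is a form of
  Hadamard's three circles theorem in which the integer exponent keeps the quotient
  single-valued.\<close>

lemma cmod_le_between_circles:
  fixes f :: "complex \<Rightarrow> complex"
  assumes f: "f holomorphic_on UNIV" and s: "0 < s" "s \<le> cmod z" "cmod z \<le> u"
    and bs: "\<And>w. cmod w = s \<Longrightarrow> cmod (f w) \<le> D * s ^ k"
    and bu: "\<And>w. cmod w = u \<Longrightarrow> cmod (f w) \<le> D * u ^ k"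
  shows "cmod (f z) \<le> D * cmod z ^ k"
proof -
  define S where "S = cball (0 :: complex) u - ball 0 s"
  have S: "closed S" "bounded S" by (auto simp: S_def intro: bounded_subset[OF bounded_cball])
  have nz: "w \<noteq> 0" if "w \<in> S" for w using that s by (auto simp: S_def)
  have hol: "(\<lambda>w. f w / w ^ k) holomorphic_on S"
    using nz by (intro holomorphic_intros holomorphic_on_subset[OF f]) auto
  have fr: "cmod w = s \<or> cmod w = u" if "w \<in> frontier S" for w
  proof (rule ccontr)
    assume n: "\<not> (cmod w = s \<or> cmod w = u)"
    have "w \<in> S" using that S frontier_subset_closed by blast
    then have "w \<in> ball 0 u - cball 0 s" using n by (auto simp: S_def)
    moreover have "ball 0 u - cball (0::complex) s \<subseteq> S" by (auto simp: S_def)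
    ultimately have "w \<in> interior S" by (meson interior_maximal open_Diff open_ball closed_cball subsetD)
    then show False using that by (simp add: frontier_def)
  qed
  have "cmod (f z / z ^ k) \<le> D"
  proof (rule maximum_modulus_frontier[where S = S and f = "\<lambda>w. f w / w ^ k"])
    show "(\<lambda>w. f w / w ^ k) holomorphic_on interior S"
      using hol interior_subset by (rule holomorphic_on_subset)
    show "continuous_on (closure S) (\<lambda>w. f w / w ^ k)"
      using hol S by (simp add: holomorphic_on_imp_continuous_on)
    show "z \<in> S" using s by (simp add: S_def)
    show "cmod (f w / w ^ k) \<le> D" if "w \<in> frontier S" for w
    proof -
      have "0 < cmod w" "cmod (f w) \<le> D * cmod w ^ k"
        using fr[OF that] bs[of w] bu[of w] s by auto
      then show ?thesis by (simp add: norm_divide norm_power pos_divide_le_eq)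
    qed
  qed (use S in auto)
  moreover have "0 < cmod z" using s by linarith
  ultimately show ?thesis by (simp add: norm_divide norm_power pos_divide_le_eq)
qed

lemma sum_power_diff_le:
  fixes c :: real
  assumes "0 \<le> c" "c < 1"
  shows "(\<Sum>k<n. c ^ (n - Suc k)) \<le> 1 / (1 - c)"
proof -
  have "(\<Sum>k<n. c ^ (n - Suc k)) = (\<Sum>k<n. c ^ k)"
    by (rule sum.nat_diff_reindex)
  also have "\<dots> \<le> (\<Sum>k. c ^ k)"
    using assms by (intro sum_le_suminf summable_geometric) auto
  finally show ?thesis using assms by (simp add: suminf_geometric)
qed

text \<open>With truncated subtraction, \<open>(l - l0) + (l0 - l)\<close> is the distance of \<open>l\<close> and \<open>l0\<close>.\<close>

lemma two_sided_geometric: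
  fixes x :: "nat \<Rightarrow> real"
  assumes x0: "\<And>l. 0 \<le> x l" and x: "\<And>l. x l \<le> B * (1 / 5) ^ ((l - l0) + (l0 - l))"
  shows "summable x" and "(\<Sum>l. if l = l0 then 0 else x l) \<le> B / 2"
proof -
  have B: "0 \<le> B" using x0[of l0] x[of l0] by simp
  define u where "u = (\<lambda>l. if l = l0 then 0 else x l)"
  have tail: "(\<lambda>l. B * (1 / 5) * (1 / 5) ^ l) sums (B * (1 / 5) * (1 / (1 - 1 / 5)))"
    by (intro sums_mult geometric_sums) simp
  have ut: "0 \<le> u (l + Suc l0)" "u (l + Suc l0) \<le> B * (1 / 5) * (1 / 5) ^ l" for l
    using x0 x[of "l + Suc l0"] by (simp_all add: u_def)
  have su': "summable (\<lambda>l. u (l + Suc l0))"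
    by (rule summable_comparison_test_ev[OF _ sums_summable[OF tail]]) (use ut in auto)
  then have su: "summable u" by (simp only: summable_iff_shift)
  have "summable (\<lambda>l. x (l + Suc l0))" using su' by (simp add: u_def)
  then show "summable x" by (simp only: summable_iff_shift)
  have "suminf u = (\<Sum>l. u (l + Suc l0)) + (\<Sum>l<Suc l0. u l)"
    by (rule suminf_split_initial_segment[OF su])
  also have "(\<Sum>l. u (l + Suc l0)) \<le> B / 4"
    using suminf_le[OF ut(2) su' sums_summable[OF tail]] sums_unique[OF tail] by simp
  also have "(\<Sum>l<Suc l0. u l) = (\<Sum>l<l0. u l)" by (simp add: u_def)
  also have "\<dots> \<le> (\<Sum>l<l0. B / 5 * (1 / 5) ^ (l0 - Suc l))"
  proof (intro sum_mono)
    fix l assume "l \<in> {..<l0}"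
    then show "u l \<le> B / 5 * (1 / 5) ^ (l0 - Suc l)"
      using x[of l] by (simp add: u_def Suc_diff_Suc[symmetric, of l l0])
  qed
  also have "\<dots> \<le> B / 5 * (1 / (1 - 1 / 5))"
    unfolding sum_distrib_left[symmetric] using B by (intro mult_left_mono sum_power_diff_le) auto
  finally show "(\<Sum>l. if l = l0 then 0 else x l) \<le> B / 2" by (simp add: u_def)
qed

text \<open>Logarithmically, \<open>L n\<close> is the supporting line of slope \<open>n\<close> to the weight, touching it at \<open>t n\<close>.\<close>

locale tropical_minorant =
  fixes \<omega> :: "real \<Rightarrow> real" and a t :: "nat \<Rightarrow> real"
  assumes pos: "\<And>r. 0 \<le> r \<Longrightarrow> 0 < \<omega> r"
    and mono: "\<And>r s. 0 \<le> r \<Longrightarrow> r \<le> s \<Longrightarrow> \<omega> r \<le> \<omega> s"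
    and a_pos: "\<And>n. 0 < a n" and t_nonneg: "\<And>n. 0 \<le> t n" and t_0: "t 0 = 0"
    and contact: "\<And>n. \<omega> (t n) = a n * t n ^ n"
    and minorant: "\<And>n r. 0 \<le> r \<Longrightarrow> a n * r ^ n \<le> \<omega> r"
begin

definition L :: "nat \<Rightarrow> real \<Rightarrow> real" where "L n r = a n * r ^ n"

lemma L_nonneg: "0 \<le> r \<Longrightarrow> 0 \<le> L n r"
  using a_pos[of n] by (simp add: L_def)

lemma t_pos: "0 < n \<Longrightarrow> 0 < t n"
  using pos[OF t_nonneg, of n] contact[of n] t_nonneg[of n] by (cases "t n = 0") (auto simp: power_0_left)

lemma L_contact: "L m (t n) \<le> L n (t n)"
  using minorant[OF t_nonneg, of m n] contact[of n] by (simp add: L_def)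

text \<open>The quotient of \<open>L j\<close> by \<open>L i\<close> is a multiple of
  \<open>r ^ (j - i)\<close>, hence nondecreasing, so a comparison at one radius persists to the
  right. The mirrored fact for smaller radii follows.\<close>

lemma L_ratio_right:
  assumes "c * L i s \<le> L j s" "i \<le> j" "0 < s" "s \<le> r" "0 \<le> c"
  shows "c * L i r \<le> L j r"
proof -
  have r: "r ^ k = s ^ k * (r / s) ^ k" for k using assms by (simp add: power_divide)
  have "c * L i r = c * L i s * (r / s) ^ i" by (simp add: L_def r[of i])
  also have "\<dots> \<le> L j s * (r / s) ^ j"
    using assms L_nonneg[of s j] by (intro mult_mono power_increasing) auto
  also have "\<dots> = L j r" by (simp add: L_def r[of j])
  finally show ?thesis .
qed

lemma L_ratio_left:
  assumes "c * L j s \<le> L i s" "i \<le> j" "0 < s" "0 \<le> r" "r \<le> s" "0 \<le> c"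
  shows "c * L j r \<le> L i r"
proof -
  have r: "r ^ k = s ^ k * (r / s) ^ k" for k using assms by (simp add: power_divide)
  have "c * L j r = c * L j s * (r / s) ^ j" by (simp add: L_def r[of j])
  also have "\<dots> \<le> L i s * (r / s) ^ i"
    using assms L_nonneg[of s i] by (intro mult_mono power_decreasing) auto
  also have "\<dots> = L i r" by (simp add: L_def r[of i])
  finally show ?thesis .
qed

text \<open>At \<open>t j\<close> the monomial \<open>L j\<close> equals the weight and so dominates
  every other one; the monotone quotient carries this on to larger radii.\<close>

lemma L_le_right: "i \<le> j \<Longrightarrow> t j \<le> r \<Longrightarrow> L i r \<le> L j r"
  using L_ratio_right[of 1 i "t j" j r] L_contact[of i j] t_pos[of j] by (cases "j = 0") auto

lemma L_le_left: "i \<le> j \<Longrightarrow> 0 \<le> r \<Longrightarrow> r \<le> t i \<Longrightarrow> L j r \<le> L i r"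
proof (cases "i = 0")
  case True
  assume "0 \<le> r" "r \<le> t i"
  then have "r = 0" using True t_0 by simp
  then show ?thesis using True a_pos[of 0] by (cases "j = 0") (auto simp: L_def less_imp_le power_0_left)
qed (use L_ratio_left[of 1 j "t i" i r] L_contact[of j i] t_pos[of i] in auto)

text \<open>A radius twice the contact point turns each unit of difference between the exponents
  into a factor 1/2. This gives geometric decay away from the two monomials that matter.\<close>

lemma L_decay_left:
  assumes "k \<le> n" "2 * t n \<le> r"
  shows "L k r \<le> (1 / 2) ^ (n - k) * L n r"
proof (cases "n = 0")
  case False
  define s where "s = t n"
  have s: "0 < s" "2 * s \<le> r" using t_pos False assms by (auto simp: s_def)
  have r: "r ^ i = s ^ i * (r / s) ^ i" for i using s by (simp add: power_divide)
  have rs: "2 \<le> r / s" using s by (simp add: field_simps)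
  have "L k r = L k s * (r / s) ^ k" by (simp add: L_def r[of k])
  also have "\<dots> \<le> L n s * (r / s) ^ k"
    using L_contact[of k n] rs by (intro mult_right_mono) (auto simp: s_def)
  also have "\<dots> \<le> L n s * ((r / s) ^ k * ((1 / 2) ^ (n - k) * (r / s) ^ (n - k)))"
  proof (intro mult_left_mono)
    have "1 \<le> (1 / 2 * (r / s)) ^ (n - k)" using rs by (intro one_le_power) auto
    then show "(r / s) ^ k \<le> (r / s) ^ k * ((1 / 2) ^ (n - k) * (r / s) ^ (n - k))"
      using rs mult_left_mono[of 1 "(1 / 2 * (r / s)) ^ (n - k)" "(r / s) ^ k"]
      by (simp only: power_mult_distrib) auto
  qed (use L_nonneg s in auto)
  also have "\<dots> = (1 / 2) ^ (n - k) * (L n s * ((r / s) ^ k * (r / s) ^ (n - k)))" by simp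
  also have "(r / s) ^ k * (r / s) ^ (n - k) = (r / s) ^ n"
    using assms by (simp flip: power_add)
  also have "L n s * (r / s) ^ n = L n r" by (simp add: L_def r[of n])
  finally show ?thesis .
qed (use assms in simp)

lemma L_decay_right:
  assumes "n \<le> k" "0 \<le> r" "2 * r \<le> t n"
  shows "L k r \<le> (1 / 2) ^ (k - n) * L n r"
proof (cases "t n = 0")
  case True
  then show ?thesis using assms L_nonneg[of r n] by (cases "k = n") (auto simp: L_def power_0_left)
next
  case False
  define s where "s = t n"
  have s: "0 < s" "2 * r \<le> s" using t_nonneg[of n] False assms by (auto simp: s_def)
  have r: "r ^ i = s ^ i * (r / s) ^ i" for i using s by (simp add: power_divide)
  have rs: "r / s \<le> 1 / 2" "0 \<le> r / s" using s assms by (auto simp: field_simps)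
  have "L k r = L k s * ((r / s) ^ n * (r / s) ^ (k - n))"
    using assms by (simp add: L_def r[of k] flip: power_add)
  also have "\<dots> \<le> L n s * ((r / s) ^ n * (1 / 2) ^ (k - n))"
    using L_contact[of k n] rs L_nonneg s
    by (intro mult_mono power_mono) (auto simp: s_def)
  also have "\<dots> = (1 / 2) ^ (k - n) * L n r" by (simp add: L_def r[of n])
  finally show ?thesis .
qed

text \<open>Minimisers may fail to be unique, but any choice of them is monotone: if
  \<open>t n < t j\<close> with \<open>j < n\<close>, the domination of \<open>L n\<close> at
  \<open>t n\<close> and of \<open>L j\<close> at \<open>t j\<close> would contradict the strict
  growth of \<open>r ^ (n - j)\<close>.\<close>

lemma t_mono:
  assumes "j \<le> n"
  shows "t j \<le> t n"
proof (cases "j = n")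
  case False
  then have tn: "0 < t n" using assms t_pos by simp
  show ?thesis
  proof (rule ccontr)
    assume "\<not> t j \<le> t n"
    then have lt: "t n < t j" by simp
    have split: "r ^ n = r ^ j * r ^ (n - j)" for r :: real
      using assms by (simp flip: power_add)
    have "a j \<le> a n * t n ^ (n - j)"
      using L_contact[of j n] tn by (simp add: L_def split)
    also have "\<dots> < a n * t j ^ (n - j)"
      using lt tn False assms a_pos[of n] by (intro mult_strict_left_mono power_strict_mono) auto
    also have "\<dots> \<le> a j"
      using L_contact[of n j] lt tn by (simp add: L_def split)
    finally show False by simp
  qed
qed simp

text \<open>If all contact points were at most \<open>R\<close>, passing from \<open>t n\<close> to
  \<open>2 * R\<close> would multiply the monomial \<open>L n\<close> by at least
  \<open>2 ^ n\<close>, while it remains below \<open>\<omega> (2 * R)\<close>.\<close>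

lemma t_unbounded: "\<exists>n. R < t n"
proof (rule ccontr)
  assume "\<not> (\<exists>n. R < t n)"
  then have le: "t n \<le> R" for n by (simp add: not_less)
  then have R: "0 \<le> R" using t_0 by metis
  have "\<omega> 0 * 2 ^ n \<le> \<omega> (2 * R)" for n
  proof -
    have "\<omega> 0 * 2 ^ n \<le> \<omega> (t n) * 2 ^ n" using mono t_nonneg by (intro mult_right_mono) auto
    also have "\<dots> = a n * (2 * t n) ^ n" by (simp add: contact power_mult_distrib)
    also have "\<dots> \<le> a n * (2 * R) ^ n"
      using a_pos[of n] le t_nonneg by (intro mult_left_mono power_mono) auto
    also have "\<dots> \<le> \<omega> (2 * R)" using minorant[of "2 * R" n] R by simp
    finally show ?thesis .
  qed
  moreover obtain n where "\<omega> (2 * R) / \<omega> 0 < 2 ^ n"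
    using real_arch_pow[of 2 "\<omega> (2 * R) / \<omega> 0"] by auto
  ultimately show False using pos[of 0] by (simp add: field_simps not_less[symmetric])
qed

section \<open>The maximal term and the bound for functions below the weight\<close>

text \<open>\<open>L N r\<close> is the maximal term and \<open>N\<close> a central index in the
  sense of Wiman and Valiron. Unimodality, rather than mere maximality at \<open>N\<close>, is
  recorded so that any two indices on the same side of \<open>N\<close> can be compared.\<close>

definition peak :: "nat \<Rightarrow> real \<Rightarrow> bool" where
  "peak N r \<longleftrightarrow> (\<forall>i j. i \<le> j \<and> j \<le> N \<longrightarrow> L i r \<le> L j r) \<and> (\<forall>i j. N \<le> i \<and> i \<le> j \<longrightarrow> L j r \<le> L i r)"

lemma peak_max: "peak N r \<Longrightarrow> L i r \<le> L N r"
  unfolding peak_def by (cases "i \<le> N") auto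

text \<open>If \<open>r\<close> lies between \<open>t n\<close> and \<open>t (Suc n)\<close>, the
  values increase up to index \<open>n\<close> and decrease from \<open>Suc n\<close> on. Only the
  comparison of these two neighbours is open, and it decides which one is the peak.\<close>

lemma peak_exists:
  assumes "0 \<le> r"
  obtains n N where "t n \<le> r" "r \<le> t (Suc n)" "N = n \<or> N = Suc n" "peak N r"
proof -
  define m where "m = (LEAST m. r < t m)"
  have m: "r < t m" unfolding m_def using t_unbounded by (rule LeastI_ex)
  moreover have "m \<noteq> 0" using m t_0 assms by (metis not_less)
  ultimately obtain n where n: "m = Suc n" "r < t (Suc n)" by (metis not0_implies_Suc)
  then have "t n \<le> r" using not_less_Least[of n "\<lambda>m. r < t m"] by (simp add: m_def not_less)
  have lo: "L i r \<le> L j r" if "i \<le> j" "j \<le> n" for i j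
  proof -
    have "t j \<le> t n" using that by (intro t_mono)
    then show ?thesis using that \<open>t n \<le> r\<close> L_le_right by simp
  qed
  have hi: "L j r \<le> L i r" if "i \<le> j" "Suc n \<le> i" for i j
  proof -
    have "t (Suc n) \<le> t i" using that by (intro t_mono)
    then show ?thesis using that n assms L_le_left by simp
  qed
  show ?thesis
  proof (cases "L (Suc n) r \<le> L n r")
    case True
    then have "L j r \<le> L i r" if "n \<le> i" "i \<le> j" for i j
      using hi[of i j] hi[of "Suc n" j] that by (cases "i = n"; cases "j = n") auto
    then have "peak n r" using lo by (auto simp: peak_def)
    then show ?thesis using that[of n n] \<open>t n \<le> r\<close> n by simp
  next
    case False
    then have "L i r \<le> L j r" if "i \<le> j" "j \<le> Suc n" for i j
      using lo[of i j] lo[of i n] that by (cases "j = Suc n"; cases "i = Suc n") auto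
    then have "peak (Suc n) r" using hi by (auto simp: peak_def)
    then show ?thesis using that[of n "Suc n"] \<open>t n \<le> r\<close> n by simp
  qed
qed

text \<open>Cauchy's inequality on the circle of radius \<open>t k\<close>, where the weight equals
  \<open>a k * t k ^ k\<close>.\<close>

lemma coefficient_le:
  assumes f: "f holomorphic_on UNIV" and le: "\<And>w. cmod (f w) \<le> \<omega> (cmod w)"
  shows "cmod ((deriv ^^ k) f 0 / fact k) \<le> a k"
proof (cases "k = 0")
  case True
  have "cmod (f 0) \<le> \<omega> 0" using le[of 0] by simp
  also have "\<dots> = a 0" using contact[of 0] t_0 by simp
  finally show ?thesis using True by simp
next
  case False
  then have tk: "0 < t k" by (simp add: t_pos)
  have "cmod ((deriv ^^ k) f 0) \<le> fact k * \<omega> (t k) / t k ^ k"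
  proof (rule Cauchy_inequality[OF _ _ tk])
    show "cmod (f w) \<le> \<omega> (t k)" if "cmod (0 - w) = t k" for w
      using le[of w] that by simp
  qed (use f holomorphic_on_imp_continuous_on in \<open>auto intro: holomorphic_on_subset continuous_on_subset\<close>)
  also have "\<dots> = fact k * a k" using tk by (simp add: contact)
  finally show ?thesis by (simp add: norm_divide divide_le_eq mult.commute)
qed

text \<open>If \<open>|z|\<close> is near \<open>t n\<close> or \<open>t (n + 1)\<close>, apply the maximum principle in the annulus between
  these radii, with the exponent of the opposite end; far from both, only two monomials matter.\<close>

lemma cmod_le_peak:
  assumes f: "f holomorphic_on UNIV" and le: "\<And>w. cmod (f w) \<le> \<omega> (cmod w)"
    and r: "t n \<le> cmod z" "cmod z \<le> t (Suc n)" and N: "peak N (cmod z)"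
  shows "cmod (f z) \<le> 4 * L N (cmod z)"
proof -
  define r where "r = cmod z"
  have r0: "0 \<le> r" by (simp add: r_def)
  have tS: "0 < t (Suc n)" by (simp add: t_pos)
  have LN: "L i r \<le> L N r" for i using N by (simp add: r_def peak_max)
  have LN0: "0 \<le> L N r" using r0 by (rule L_nonneg)
  have on: "cmod (f w) \<le> a k * t k ^ k" if "cmod w = t k" for w k
    using le[of w] contact[of k] that by simp
  \<comment> \<open>The index \<open>n = 0\<close> is left to the other two cases because
    \<open>t 0 = 0\<close>.\<close>
  consider (near) "0 < n" "r \<le> 2 * t n" | (near_Suc) "t (Suc n) \<le> 2 * r"
    | (far) "2 * t n \<le> r" "2 * r \<le> t (Suc n)"
    using t_0 r0 by (cases "n = 0") force+
  then show ?thesis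
  proof cases
    case near
    then have tn: "0 < t n" by (simp add: t_pos)
    \<comment> \<open>With exponent \<open>Suc n\<close> the coefficient \<open>a n / t n\<close> is
      exact on the inner circle and sufficient on the outer one. At \<open>r\<close> it overshoots
      \<open>L n r\<close> by the factor \<open>r / t n\<close>, which is at most 2 here.\<close>
    have "a (Suc n) \<le> a n / t n" using L_contact[of "Suc n" n] tn by (simp add: L_def field_simps)
    then have "a (Suc n) * t (Suc n) ^ Suc n \<le> a n / t n * t (Suc n) ^ Suc n"
      using tS by (intro mult_right_mono) auto
    then have "cmod (f z) \<le> a n / t n * cmod z ^ Suc n"
      using on[of _ n] on[of _ "Suc n"] tn r
      by (intro cmod_le_between_circles[OF f tn, where u = "t (Suc n)"]) (force intro: order_trans)+
    also have "\<dots> = r / t n * L n r" by (simp add: L_def r_def)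
    also have "\<dots> \<le> 2 * L n r" using near tn L_nonneg[OF r0] by (intro mult_right_mono) (auto simp: field_simps)
    finally show ?thesis using LN[of n] LN0 by (simp add: r_def)
  next
    case near_Suc
    have "cmod (f z) \<le> a (Suc n) * t (Suc n) * cmod z ^ n"
    \<comment> \<open>For \<open>n = 0\<close> the inner circle shrinks to the origin, and
      monotonicity of the weight takes the place of the annulus.\<close>
    proof (cases "n = 0")
      case True
      have "cmod (f z) \<le> \<omega> (t (Suc n))" using le[of z] mono[of "cmod z" "t (Suc n)"] r by simp
      then show ?thesis using contact[of "Suc n"] True by simp
    next
      case False
      then have tn: "0 < t n" by (simp add: t_pos)
      have "a n \<le> a (Suc n) * t (Suc n)" using L_contact[of n "Suc n"] tS by (simp add: L_def field_simps)
      then have "a n * t n ^ n \<le> a (Suc n) * t (Suc n) * t n ^ n"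
        using tn by (intro mult_right_mono) auto
      then show ?thesis
        using on[of _ n] on[of _ "Suc n"] tn r
        by (intro cmod_le_between_circles[OF f tn, where u = "t (Suc n)"])
           (force simp: mult.assoc intro: order_trans)+
    qed
    also have "\<dots> \<le> a (Suc n) * (2 * r) * cmod z ^ n"
      using near_Suc a_pos[of "Suc n"] by (intro mult_right_mono mult_left_mono) auto
    also have "\<dots> = 2 * L (Suc n) r" by (simp add: L_def r_def)
    finally show ?thesis using LN[of "Suc n"] LN0 by (simp add: r_def)
  next
    case far
    \<comment> \<open>Halving downwards from \<open>n\<close> and upwards from \<open>Suc n\<close>:
      each side sums to at most 2, whence the factor 4.\<close>
    define x where "x = (\<lambda>k. if k \<le> n then (1 / 2) ^ (n - k) else (1 / 2 :: real) ^ (k - Suc n))"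
    have Lx: "L k r \<le> L N r * x k" for k
    proof (cases "k \<le> n")
      case True
      have "L k r \<le> (1 / 2) ^ (n - k) * L n r" using True far by (intro L_decay_left) auto
      also have "\<dots> \<le> (1 / 2) ^ (n - k) * L N r" using LN by (intro mult_left_mono) auto
      finally show ?thesis using True by (simp add: x_def mult.commute)
    next
      case False
      have "L k r \<le> (1 / 2) ^ (k - Suc n) * L (Suc n) r" using False far r0 by (intro L_decay_right) auto
      also have "\<dots> \<le> (1 / 2) ^ (k - Suc n) * L N r" using LN by (intro mult_left_mono) auto
      finally show ?thesis using False by (simp add: x_def mult.commute)
    qed
    have tail: "(\<lambda>k. x (k + Suc n)) = (\<lambda>k. (1 / 2) ^ k)" by (auto simp: x_def)
    have sx: "summable x"
      using summable_geometric[of "1 / 2 :: real"] unfolding tail[symmetric] by (simp only: summable_iff_shift) simp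
    have "suminf x = (\<Sum>k. x (k + Suc n)) + (\<Sum>k<Suc n. x k)"
      by (rule suminf_split_initial_segment[OF sx])
    also have "(\<Sum>k. x (k + Suc n)) = 2" unfolding tail by (simp add: suminf_geometric)
    also have "(\<Sum>k<Suc n. x k) = (\<Sum>k<Suc n. (1 / 2) ^ (Suc n - Suc k))"
      by (intro sum.cong) (auto simp: x_def)
    also have "\<dots> \<le> 1 / (1 - 1 / 2)" by (rule sum_power_diff_le) auto
    finally have x4: "suminf x \<le> 4" by simp
    have sums: "(\<lambda>k. (deriv ^^ k) f 0 / fact k * (z - 0) ^ k) sums f z"
      using f by (intro holomorphic_power_series[of f 0 "cmod z + 1"]) (auto intro: holomorphic_on_subset)
    have coeff: "cmod ((deriv ^^ k) f 0 / fact k * (z - 0) ^ k) \<le> L N r * x k" for k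
    proof -
      have "cmod ((deriv ^^ k) f 0 / fact k * (z - 0) ^ k) \<le> a k * r ^ k"
        using mult_right_mono[OF coefficient_le[OF f le], of "r ^ k" k] r0
        by (simp add: norm_mult norm_power norm_divide r_def)
      also have "\<dots> \<le> L N r * x k" using Lx[of k] by (simp add: L_def)
      finally show ?thesis .
    qed
    have "cmod (f z) \<le> (\<Sum>k. L N r * x k)"
      unfolding sums_unique[OF sums] using coeff sx by (intro norm_suminf_le summable_mult) auto
    also have "\<dots> = L N r * suminf x" by (rule suminf_mult[OF sx])
    also have "\<dots> \<le> L N r * 4" using x4 LN0 by (intro mult_left_mono)
    finally show ?thesis by (simp add: r_def mult.commute)
  qed
qed

section \<open>Thinning out the exponents\<close>

text \<open>A pair \<open>p < m\<close> is separated if at some radius a line of intermediate slope exceeds both by the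
  factor 5. Keeping from each index onwards the last one before separation occurs yields indices
  whose lines still describe the envelope up to the factor 5, while lines two apart are separated.\<close>

definition separated :: "nat \<Rightarrow> nat \<Rightarrow> bool" where
  "separated p m \<longleftrightarrow> (\<exists>s>0. \<exists>j. p < j \<and> j < m \<and> 5 * L p s \<le> L j s \<and> 5 * L m s \<le> L j s)"

text \<open>Take the radius at which \<open>L (Suc p)\<close> is exactly five times
  \<open>L p\<close>, with \<open>Suc p\<close> as the intermediate index. There \<open>L m\<close>
  tends to 0 as \<open>m\<close> grows, since the contact points of large index lie far beyond that
  radius.\<close>

lemma separated_exists: "\<exists>m>p. separated p m"
proof -
  define s where "s = 5 * a p / a (Suc p)"
  have s: "0 < s" using a_pos by (simp add: s_def)
  have eq: "5 * L p s = L (Suc p) s" using a_pos[of "Suc p"] by (simp add: L_def s_def)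
  obtain n where n: "2 * s < t n" using t_unbounded by blast
  define n' where "n' = max n (Suc p)"
  have n': "2 * s \<le> t n'" using n t_mono[of n n'] by (simp add: n'_def)
  have "0 < L (Suc p) s / (5 * (1 + L n' s))"
    using s a_pos[of "Suc p"] L_nonneg[of s n'] by (simp add: L_def)
  then obtain k where k: "(1 / 2) ^ k < L (Suc p) s / (5 * (1 + L n' s))"
    using real_arch_pow_inv[of _ "1 / 2"] by fastforce
  define m where "m = n' + Suc k"
  have "5 * L m s \<le> 5 * ((1 / 2) ^ (m - n') * L n' s)"
    using n' s by (intro mult_left_mono L_decay_right) (auto simp: m_def)
  also have "\<dots> \<le> (1 / 2) ^ k * (5 * (1 + L n' s))"
    using L_nonneg[of s n'] s by (simp add: m_def)
  also have "\<dots> \<le> L (Suc p) s" using k L_nonneg[of s n'] s by (simp add: field_simps)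
  finally have "5 * L m s \<le> L (Suc p) s" .
  then have "separated p m"
    unfolding separated_def using eq s by (intro exI[of _ s] exI[of _ "Suc p"]) (auto simp: m_def n'_def)
  moreover have "p < m" by (simp add: m_def n'_def)
  ultimately show ?thesis by blast
qed

text \<open>Subtracting 1 gives the last index that is still not separated from \<open>p\<close>. It
  exceeds \<open>p\<close>, because separation requires an index strictly in between.\<close>

definition next_index :: "nat \<Rightarrow> nat" where
  "next_index p = (LEAST m. p < m \<and> separated p m) - 1"

lemma next_index:
  shows "p < next_index p" and "separated p (Suc (next_index p))"
    and "m \<le> next_index p \<Longrightarrow> p < m \<Longrightarrow> \<not> separated p m"
proof -
  define l where "l = (LEAST m. p < m \<and> separated p m)"
  have l: "p < l \<and> separated p l"
    unfolding l_def using separated_exists by (rule LeastI_ex)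
  then have l2: "Suc p < l" by (auto simp: separated_def)
  have n: "next_index p = l - 1" by (simp add: next_index_def l_def)
  show "p < next_index p" using l2 n by simp
  show "separated p (Suc (next_index p))" using l l2 n by simp
  show "\<not> separated p m" if "m \<le> next_index p" "p < m"
    using not_less_Least[of m "\<lambda>m. p < m \<and> separated p m"] that l2 n by (auto simp: l_def)
qed

definition idx :: "nat \<Rightarrow> nat" where "idx i = (next_index ^^ i) 0"

lemma idx_0: "idx 0 = 0" and idx_Suc: "idx (Suc i) = next_index (idx i)"
  by (simp_all add: idx_def)

lemma strict_mono_idx: "strict_mono idx"
  by (simp add: strict_mono_Suc_iff idx_Suc next_index)

lemma separation:
  obtains s j where "0 < s" "idx i < j" "j \<le> idx (Suc i)"
    "5 * L (idx i) s \<le> L j s" "5 * L (Suc (idx (Suc i))) s \<le> L j s"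
  using next_index(2)[of "idx i"] unfolding separated_def idx_Suc[symmetric]
  by (auto simp: less_Suc_eq_le)

text \<open>If the separating radius \<open>s\<close> is at most \<open>r\<close>, the gain over
  \<open>L (idx i)\<close> persists up to \<open>r\<close>, and monotonicity below the peak passes
  it on. Otherwise the smaller index \<open>j\<close> would beat \<open>Suc (idx (Suc i))\<close>
  fivefold at \<open>r\<close>, although the values still increase there, so these values
  vanish.\<close>

lemma decay_below_peak:
  assumes "0 \<le> r" and N: "peak N r" and i: "idx (Suc i) < N"
  shows "5 * L (idx i) r \<le> L (idx (Suc i)) r"
proof -
  obtain s j where s: "0 < s" and j: "idx i < j" "j \<le> idx (Suc i)"
    and lo: "5 * L (idx i) s \<le> L j s" and hi: "5 * L (Suc (idx (Suc i))) s \<le> L j s"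
    by (rule separation)
  have inc: "L k r \<le> L k' r" if "k \<le> k'" "k' \<le> N" for k k' using N that by (simp add: peak_def)
  show ?thesis
  proof (cases "s \<le> r")
    case True
    have "5 * L (idx i) r \<le> L j r" using j s True by (intro L_ratio_right[OF lo]) auto
    also have "\<dots> \<le> L (idx (Suc i)) r" using i j by (intro inc) auto
    finally show ?thesis .
  next
    case False
    have "5 * L (Suc (idx (Suc i))) r \<le> L j r"
      using j s assms(1) False by (intro L_ratio_left[OF hi]) auto
    also have "\<dots> \<le> L (Suc (idx (Suc i))) r" using i j by (intro inc) auto
    finally have "L (Suc (idx (Suc i))) r \<le> 0" by simp
    moreover have "L (idx i) r \<le> L (Suc (idx (Suc i))) r" using i j by (intro inc) auto
    ultimately show ?thesis using L_nonneg[OF \<open>0 \<le> r\<close>, of "idx (Suc i)"] by simp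
  qed
qed

text \<open>Two steps are taken because the index separated from \<open>idx i\<close> is
  \<open>Suc (idx (Suc i))\<close>, one more than the next selected index; only
  \<open>idx (Suc (Suc i))\<close> is sure to lie at or beyond it.\<close>

lemma decay_above_peak:
  assumes "0 \<le> r" and N: "peak N r" and i: "N \<le> idx i"
  shows "5 * L (idx (Suc (Suc i))) r \<le> L (idx i) r"
proof -
  obtain s j where s: "0 < s" and j: "idx i < j" "j \<le> idx (Suc i)"
    and lo: "5 * L (idx i) s \<le> L j s" and hi: "5 * L (Suc (idx (Suc i))) s \<le> L j s"
    by (rule separation)
  have dec: "L k' r \<le> L k r" if "N \<le> k" "k \<le> k'" for k k' using N that by (simp add: peak_def)
  have next2: "Suc (idx (Suc i)) \<le> idx (Suc (Suc i))"
    using strict_mono_idx by (simp add: strict_mono_Suc_iff Suc_le_eq)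
  show ?thesis
  proof (cases "r \<le> s")
    case True
    have "5 * L (idx (Suc (Suc i))) r \<le> 5 * L (Suc (idx (Suc i))) r"
      using i j next2 by (intro mult_left_mono dec) auto
    also have "\<dots> \<le> L j r" using j s assms(1) True by (intro L_ratio_left[OF hi]) auto
    also have "\<dots> \<le> L (idx i) r" using i j by (intro dec) auto
    finally show ?thesis .
  next
    case False
    have "5 * L (idx i) r \<le> L j r" using j s False by (intro L_ratio_right[OF lo]) auto
    also have "\<dots> \<le> L (idx i) r" using i j by (intro dec) auto
    finally have "L (idx i) r \<le> 0" by simp
    moreover have "L (idx (Suc (Suc i))) r \<le> L (idx i) r" using i j next2 by (intro dec) auto
    ultimately show ?thesis using L_nonneg[OF \<open>0 \<le> r\<close>, of "idx i"] by simp
  qed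
qed

text \<open>Consecutive selected indices are not separated when some index lies strictly between
  them, so no intermediate monomial exceeds both fivefold.\<close>

lemma peak_le_idx:
  assumes "0 \<le> r" "idx i \<le> N" "N \<le> idx (Suc i)"
  shows "L N r \<le> 5 * max (L (idx i) r) (L (idx (Suc i)) r)"
proof (cases "N = idx i \<or> N = idx (Suc i)")
  case True
  then show ?thesis using L_nonneg[OF \<open>0 \<le> r\<close>, of N] by auto
next
  case False
  then have N: "idx i < N" "N < idx (Suc i)" using assms by auto
  have ns: "\<not> separated (idx i) (idx (Suc i))"
    using N by (intro next_index(3)) (auto simp: idx_Suc)
  show ?thesis
  proof (cases "r = 0")
    case True
    then show ?thesis using N L_nonneg[of 0 "idx i"] by (auto simp: L_def power_0_left)
  next
    case False
    then have "\<not> (5 * L (idx i) r \<le> L N r \<and> 5 * L (idx (Suc i)) r \<le> L N r)"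
      using ns N assms unfolding separated_def by auto
    then show ?thesis by auto
  qed
qed

definition crossing :: "nat \<Rightarrow> nat" where "crossing N = (LEAST k. N \<le> idx k)"

lemma crossing: "N \<le> idx (crossing N)" "k < crossing N \<Longrightarrow> idx k < N"
proof -
  have "N \<le> idx N" using strict_mono_idx by (rule strict_mono_imp_increasing)
  then show "N \<le> idx (crossing N)" unfolding crossing_def by (rule LeastI)
  show "idx k < N" if "k < crossing N"
    using not_less_Least[OF that[unfolded crossing_def]] by simp
qed

lemma idx_ge_crossing: "crossing N \<le> k \<Longrightarrow> N \<le> idx k"
  using crossing(1)[of N] strict_mono_less_eq[OF strict_mono_idx, of "crossing N" k] by simp

lemma decay_3_above:
  assumes "0 \<le> r" "peak N r" "crossing N \<le> i"
  shows "5 * L (idx (i + 3)) r \<le> L (idx i) r"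
proof -
  have i: "N \<le> idx i" using assms by (intro idx_ge_crossing)
  have "L (idx (i + 3)) r \<le> L (idx (Suc (Suc i))) r"
    using assms idx_ge_crossing[of N "Suc (Suc i)"] strict_mono_less_eq[OF strict_mono_idx, of "Suc (Suc i)" "i + 3"]
    by (simp add: peak_def)
  then show ?thesis using decay_above_peak[OF assms(1,2) i] by simp
qed

lemma decay_3_below:
  assumes r: "0 \<le> r" and N: "peak N r" and i: "i + 3 < crossing N"
  shows "5 * L (idx i) r \<le> L (idx (i + 3)) r"
proof -
  have step: "5 * L (idx j) r \<le> L (idx (Suc j)) r" if "Suc j < crossing N" for j
    using decay_below_peak[OF r N] crossing(2)[OF that] by simp
  have "5 * L (idx i) r \<le> L (idx (Suc i)) r" "5 * L (idx (Suc i)) r \<le> L (idx (Suc (Suc i))) r"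
    "5 * L (idx (Suc (Suc i))) r \<le> L (idx (Suc (Suc (Suc i)))) r"
    using i by (auto intro!: step)
  moreover have "i + 3 = Suc (Suc (Suc i))" by simp
  ultimately show ?thesis
    using L_nonneg[OF r, of "idx (Suc i)"] L_nonneg[OF r, of "idx (Suc (Suc i))"] by (simp only:)
qed

text \<open>The pivot \<open>i\<close> is one of the two selected indices adjacent to \<open>N\<close>; stepping by three away
  from either of them decays geometrically relative to the larger of their two values.\<close>

lemma decay_from_pivot:
  assumes r: "0 \<le> r" and N: "peak N r" and i: "i = crossing N \<or> Suc i = crossing N"
    and M: "L (idx i) r \<le> M" "L (idx (crossing N)) r \<le> M" "L (idx (crossing N - 1)) r \<le> M"
  shows "L (idx (i + 3 * d)) r \<le> M * (1 / 5) ^ d"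
    and "j + 3 * d = i \<Longrightarrow> L (idx j) r \<le> M * (1 / 5) ^ d"
proof -
  have M0: "0 \<le> M" using M(1) L_nonneg[OF r] by (rule order_trans[rotated])
  show "L (idx (i + 3 * d)) r \<le> M * (1 / 5) ^ d"
  proof (induction d)
    case (Suc d)
    show ?case
    proof (cases "crossing N \<le> i + 3 * d")
      case True
      have "5 * L (idx (i + 3 * d + 3)) r \<le> L (idx (i + 3 * d)) r"
        using decay_3_above[OF r N True] .
      then show ?thesis using Suc by (simp add: algebra_simps)
    next
      \<comment> \<open>The only stride that crosses the peak leads from
        \<open>crossing N - 1\<close> to \<open>crossing N + 2\<close>. Its last two steps lie above
        the peak and supply the decay.\<close>
      case False
      then have "Suc i = crossing N" "d = 0" using i by auto
      then show ?thesis
        using decay_above_peak[OF r N crossing(1)] M by (simp add: numeral_3_eq_3)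
    qed
  qed (use M in simp)
  show "L (idx j) r \<le> M * (1 / 5) ^ d" if "j + 3 * d = i"
    using that
  proof (induction d arbitrary: j)
    case (Suc d)
    then have IH: "L (idx (j + 3)) r \<le> M * (1 / 5) ^ d" by simp
    show ?case
    proof (cases "j + 3 < crossing N")
      case True
      show ?thesis using decay_3_below[OF r N True] IH by simp
    next
      case False
      then have jN: "j + 3 = crossing N" "d = 0" using i Suc.prems by auto
      have "5 * L (idx j) r \<le> L (idx (Suc j)) r"
        using jN by (intro decay_below_peak[OF r N] crossing) auto
      moreover have "5 * L (idx (Suc j)) r \<le> L (idx (Suc (Suc j))) r"
        using jN by (intro decay_below_peak[OF r N] crossing) auto
      moreover have "crossing N - 1 = Suc (Suc j)" using jN by simp
      ultimately show ?thesis using M(3) jN L_nonneg[OF r, of "idx (Suc j)"] M0 by simp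
    qed
  qed (use M in simp)
qed

text \<open>Unlike the estimate from the pivot, this holds for every residue class, also one without
  a large term. The term \<open>l0\<close> is the first of its class at or beyond the crossing;
  below it the decay is counted from \<open>l0 - 1\<close>, and the factor 5 makes up for that
  missing step.\<close>

lemma decay_all:
  assumes r: "0 \<le> r" and N: "peak N r"
  shows "\<exists>l0. \<forall>l. L (idx (p + 3 * l)) r \<le> 5 * L N r * (1 / 5) ^ ((l - l0) + (l0 - l))"
proof -
  define l0 where "l0 = (LEAST l. crossing N \<le> p + 3 * l)"
  have l0: "crossing N \<le> p + 3 * l0"
    unfolding l0_def by (rule LeastI[of _ "crossing N"]) simp
  have less: "p + 3 * l < crossing N" if "l < l0" for l
    using not_less_Least[OF that[unfolded l0_def]] by simp
  have LN0: "0 \<le> L N r" using r by (rule L_nonneg)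
  have up: "L (idx (p + 3 * (l0 + d))) r \<le> L N r * (1 / 5) ^ d" for d
  proof (induction d)
    case (Suc d)
    have "5 * L (idx (p + 3 * (l0 + d) + 3)) r \<le> L (idx (p + 3 * (l0 + d))) r"
      using l0 by (intro decay_3_above[OF r N]) simp
    then show ?case using Suc by (simp add: algebra_simps)
  qed (simp add: peak_max[OF N])
  have down: "Suc (l + d) = l0 \<Longrightarrow> L (idx (p + 3 * l)) r \<le> L N r * (1 / 5) ^ d" for l d
  proof (induction d arbitrary: l)
    case (Suc d)
    have "5 * L (idx (p + 3 * l)) r \<le> L (idx (p + 3 * l + 3)) r"
      using less[of "Suc l"] Suc.prems by (intro decay_3_below[OF r N]) simp
    then show ?case using Suc.IH[of "Suc l"] Suc.prems by (simp add: algebra_simps)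
  qed (simp add: peak_max[OF N])
  have "L (idx (p + 3 * l)) r \<le> 5 * L N r * (1 / 5) ^ ((l - l0) + (l0 - l))" for l
  proof (cases "l0 \<le> l")
    case True
    then have "L (idx (p + 3 * l)) r \<le> 1 * (L N r * (1 / 5) ^ (l - l0))" using up[of "l - l0"] by simp
    also have "\<dots> \<le> 5 * (L N r * (1 / 5) ^ (l - l0))" using LN0 by (intro mult_right_mono) auto
    finally show ?thesis using True by simp
  next
    case False
    then obtain d where d: "l0 = Suc (l + d)" by (metis less_imp_Suc_add not_less)
    then show ?thesis using down[of l d] by simp
  qed
  then show ?thesis by blast
qed

text \<open>The class is that of the larger of the two selected terms adjacent to the peak. If the
  crossing is 0, truncated subtraction makes the two coincide.\<close>

lemma dominant_residue:
  assumes r: "0 \<le> r" and N: "peak N r"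
  obtains p l0 M where "p < 3" "L (idx (p + 3 * l0)) r = M" "L N r \<le> 5 * M"
    "\<And>l. L (idx (p + 3 * l)) r \<le> M * (1 / 5) ^ ((l - l0) + (l0 - l))"
proof -
  define K where "K = crossing N"
  define M where "M = max (L (idx (K - 1)) r) (L (idx K) r)"
  have "L N r \<le> 5 * M"
  proof (cases "K = 0")
    case True
    then have "N = idx K" using crossing(1)[of N] idx_0 by (simp add: K_def)
    then show ?thesis using L_nonneg[OF r, of N] by (simp add: M_def)
  next
    case False
    then have "idx (K - 1) \<le> N" "N \<le> idx (Suc (K - 1))"
      using crossing(1)[of N] crossing(2)[of "K - 1" N] by (auto simp: K_def)
    from peak_le_idx[OF r this] show ?thesis using False by (simp add: M_def)
  qed
  moreover obtain i where i: "i = K \<or> Suc i = K" "L (idx i) r = M"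
  proof (cases "L (idx (K - 1)) r \<le> L (idx K) r")
    case True
    then show ?thesis using that[of K] by (simp add: M_def)
  next
    case False
    then have "K \<noteq> 0" by (cases K) auto
    then show ?thesis using that[of "K - 1"] False by (simp add: M_def)
  qed
  define p l0 where "p = i mod 3" and "l0 = i div 3"
  have pl: "p < 3" "i = p + 3 * l0" by (simp_all add: p_def l0_def)
  have "L (idx (p + 3 * l)) r \<le> M * (1 / 5) ^ ((l - l0) + (l0 - l))" for l
  proof (cases "l0 \<le> l")
    case True
    have "L (idx (i + 3 * (l - l0))) r \<le> M * (1 / 5) ^ (l - l0)"
      using i by (intro decay_from_pivot[OF r N]) (auto simp: K_def M_def)
    then show ?thesis using True pl by (simp add: algebra_simps)
  next
    case False
    have "L (idx (p + 3 * l)) r \<le> M * (1 / 5) ^ (l0 - l)"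
      using i False pl(2) by (intro decay_from_pivot(2)[OF r N, of i]) (auto simp: K_def M_def)
    then show ?thesis using False by simp
  qed
  ultimately show ?thesis using that pl i(2) by blast
qed

section \<open>The lacunary series\<close>

definition lacunary :: "nat \<Rightarrow> complex \<Rightarrow> complex" where
  "lacunary p z = (\<Sum>l. of_real (a (idx (p + 3 * l))) * z ^ idx (p + 3 * l))"

lemma norm_lacunary_term:
  "cmod (of_real (a n) * z ^ n) = L n (cmod z)"
  using a_pos[of n] by (simp add: L_def norm_mult norm_power)

lemma summable_lacunary:
  "summable (\<lambda>l. cmod (of_real (a (idx (p + 3 * l))) * z ^ idx (p + 3 * l)))"
proof -
  obtain N where N: "peak N (cmod z)" by (rule peak_exists[of "cmod z"]) auto
  obtain l0 where "\<And>l. L (idx (p + 3 * l)) (cmod z) \<le> 5 * L N (cmod z) * (1 / 5) ^ ((l - l0) + (l0 - l))"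
    using decay_all[OF norm_ge_zero N] by blast
  then show ?thesis unfolding norm_lacunary_term
    by (intro two_sided_geometric(1)) (auto simp: L_nonneg)
qed

lemma lacunary_holomorphic: "lacunary p holomorphic_on UNIV"
proof -
  \<comment> \<open>Filling the gaps with zero coefficients turns the lacunary series into an
    ordinary power series.\<close>
  define c where "c = (\<lambda>n. if n \<in> range (\<lambda>l. idx (p + 3 * l)) then complex_of_real (a n) else 0)"
  have mono3: "strict_mono (\<lambda>l. idx (p + 3 * l))"
    using strict_mono_less[OF strict_mono_idx] by (auto intro!: strict_monoI)
  have "(\<lambda>n. c n * (z - 0) ^ n) sums lacunary p z" for z
  proof -
    have "(\<lambda>l. of_real (a (idx (p + 3 * l))) * z ^ idx (p + 3 * l)) sums lacunary p z"
      unfolding lacunary_def by (rule summable_sums[OF summable_norm_cancel[OF summable_lacunary]])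
    then have "(\<lambda>l. c (idx (p + 3 * l)) * (z - 0) ^ idx (p + 3 * l)) sums lacunary p z"
      by (simp add: c_def)
    then show ?thesis by (subst (asm) sums_mono_reindex[OF mono3]) (auto simp: c_def)
  qed
  then have "lacunary p holomorphic_on ball 0 r" for r
    by (intro power_series_holomorphic) auto
  then have "lacunary p holomorphic_on (\<Union>r. ball 0 r)"
    by (intro holomorphic_on_UN_open) auto
  moreover have "(\<Union>r. ball (0 :: complex) r) = UNIV"
  proof -
    have "z \<in> ball 0 (cmod z + 1)" for z by simp
    then show ?thesis by blast
  qed
  ultimately show ?thesis by simp
qed

text \<open>The term \<open>l0\<close> is at most the maximal term, and all others together are at
  most 5/2 of it; the constant 8 leaves room.\<close>

lemma lacunary_le: "cmod (lacunary p z) \<le> 8 * \<omega> (cmod z)"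
proof -
  define r where "r = cmod z"
  have r: "0 \<le> r" by (simp add: r_def)
  obtain N where N: "peak N r" by (rule peak_exists[OF r]) auto
  let ?x = "\<lambda>l. L (idx (p + 3 * l)) r"
  obtain l0 where l0: "\<And>l. ?x l \<le> 5 * L N r * (1 / 5) ^ ((l - l0) + (l0 - l))"
    using decay_all[OF r N] by blast
  have x: "summable ?x" "(\<Sum>l. if l = l0 then 0 else ?x l) \<le> 5 * L N r / 2"
    using l0 by (intro two_sided_geometric[of ?x "5 * L N r" l0]; simp add: L_nonneg[OF r])+
  have single: "(\<lambda>l. if l = l0 then ?x l else 0) sums ?x l0"
    using sums_single[of l0 ?x] by simp
  have rest: "summable (\<lambda>l. if l = l0 then 0 else ?x l)"
    by (rule summable_comparison_test_ev[OF _ x(1)]) (auto simp: L_nonneg[OF r])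
  have "cmod (lacunary p z) \<le> suminf ?x"
    unfolding lacunary_def using summable_norm[OF summable_lacunary[of p z]]
    by (simp add: norm_lacunary_term r_def)
  also have "suminf ?x = (\<Sum>l. (if l = l0 then ?x l else 0) + (if l = l0 then 0 else ?x l))"
    by (intro arg_cong[where f = suminf]) auto
  also have "\<dots> = ?x l0 + (\<Sum>l. if l = l0 then 0 else ?x l)"
    using suminf_add[OF sums_summable[OF single] rest] sums_unique[OF single] by simp
  also have "\<dots> \<le> L N r + 5 * L N r / 2"
    using x(2) peak_max[OF N] by (intro add_mono)
  also have "\<dots> \<le> 8 * L N r" using L_nonneg[OF r, of N] by simp
  also have "\<dots> \<le> 8 * \<omega> r" using minorant[OF r, of N] by (simp add: L_def)
  finally show ?thesis by (simp add: r_def)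
qed

text \<open>In the dominant class the remaining terms amount to at most half of the largest one,
  \<open>M\<close>, so no cancellation can bring the sum below \<open>M / 2\<close>. The constant is
  \<open>5 * 2\<close>.\<close>

lemma peak_le_lacunary:
  assumes N: "peak N (cmod z)"
  shows "\<exists>p<3. L N (cmod z) \<le> 10 * cmod (lacunary p z)"
proof -
  define r where "r = cmod z"
  have r: "0 \<le> r" by (simp add: r_def)
  obtain p l0 M where p: "p < 3" and M: "L (idx (p + 3 * l0)) r = M" "L N r \<le> 5 * M"
    and l0: "\<And>l. L (idx (p + 3 * l)) r \<le> M * (1 / 5) ^ ((l - l0) + (l0 - l))"
    using dominant_residue[OF r N[folded r_def]] by metis
  let ?y = "\<lambda>l. of_real (a (idx (p + 3 * l))) * z ^ idx (p + 3 * l)"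
  let ?u = "\<lambda>l. if l = l0 then 0 else ?y l"
  have ny: "cmod (?y l) = L (idx (p + 3 * l)) r" for l
    by (simp only: norm_lacunary_term r_def)
  have nu: "(\<lambda>l. cmod (?u l)) = (\<lambda>l. if l = l0 then 0 else L (idx (p + 3 * l)) r)"
    using ny by auto
  have x: "(\<Sum>l. if l = l0 then 0 else L (idx (p + 3 * l)) r) \<le> M / 2"
    using l0 by (intro two_sided_geometric) (auto simp: L_nonneg[OF r])
  have su: "summable (\<lambda>l. cmod (?u l))"
    by (rule summable_comparison_test_ev[OF _ summable_lacunary[of p z]]) auto
  have single: "(\<lambda>l. if l = l0 then ?y l else 0) sums ?y l0"
    using sums_single[of l0 ?y] by simp
  have "lacunary p z = (\<Sum>l. (if l = l0 then ?y l else 0) + ?u l)"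
    unfolding lacunary_def by (intro arg_cong[where f = suminf]) auto
  also have "\<dots> = ?y l0 + suminf ?u"
    using suminf_add[OF sums_summable[OF single] summable_norm_cancel[OF su]] sums_unique[OF single] by simp
  finally have "cmod (?y l0) \<le> cmod (lacunary p z) + cmod (suminf ?u)"
    using norm_triangle_ineq2[of "?y l0" "- suminf ?u"] by simp
  also have "cmod (suminf ?u) \<le> M / 2"
    using summable_norm[OF su] x unfolding nu by linarith
  finally have "M \<le> 2 * cmod (lacunary p z)" using ny[of l0] M(1) by simp
  then show ?thesis using p M(2) unfolding r_def by (intro exI[of _ p]) simp
qed

lemma cmod_le_lacunary:
  assumes f: "f holomorphic_on UNIV" and le: "\<And>w. cmod (f w) \<le> \<omega> (cmod w)"
  shows "cmod (f z) \<le> 40 * (\<Sum>p<3. cmod (lacunary p z))"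
proof -
  obtain n N where n: "t n \<le> cmod z" "cmod z \<le> t (Suc n)" and N: "peak N (cmod z)"
    by (rule peak_exists[OF norm_ge_zero[of z]])
  obtain p where p: "p < 3" "L N (cmod z) \<le> 10 * cmod (lacunary p z)"
    using peak_le_lacunary[OF N] by blast
  have "cmod (f z) \<le> 4 * L N (cmod z)" by (rule cmod_le_peak[OF f le n N])
  also have "\<dots> \<le> 40 * cmod (lacunary p z)" using p by simp
  also have "cmod (lacunary p z) \<le> (\<Sum>p<3. cmod (lacunary p z))"
    using p by (intro member_le_sum) auto
  finally show ?thesis by simp
qed

end

text \<open>The last property speaks of single functions below the weight; the supremum over them
  turns it into a lower bound for the family in terms of the associated weight.\<close>

theorem weight_function_test_functions:
  assumes "weight_function \<omega>"
  obtains F :: "nat \<Rightarrow> complex \<Rightarrow> complex" where "\<And>p. F p holomorphic_on UNIV"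
    "\<And>p z. cmod (F p z) \<le> 8 * \<omega> (cmod z)"
    "\<And>f z. f holomorphic_on UNIV \<Longrightarrow> (\<And>w. cmod (f w) \<le> \<omega> (cmod w)) \<Longrightarrow>
       cmod (f z) \<le> 40 * (\<Sum>p<3. cmod (F p z))"
proof -
  have "\<exists>b s. 0 < b \<and> 0 \<le> s \<and> (n = 0 \<longrightarrow> s = 0) \<and> \<omega> s = b * s ^ n \<and> (\<forall>r\<ge>0. b * r ^ n \<le> \<omega> r)" for n
    by (rule weight_function_contact[OF assms, of n]) blast
  then obtain a t where at: "\<And>n. 0 < a n \<and> 0 \<le> t n \<and> (n = 0 \<longrightarrow> t n = 0) \<and>
      \<omega> (t n) = a n * t n ^ n \<and> (\<forall>r\<ge>0. a n * r ^ n \<le> \<omega> r)"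
    by metis
  interpret tropical_minorant \<omega> a t
    using assms at by unfold_locales (auto simp: weight_function_def mono_on_def)
  show ?thesis
    using that[of lacunary] lacunary_holomorphic lacunary_le cmod_le_lacunary by blast
qed

section \<open>The Volterra-type operator\<close>

lemma associated_weight_bdd:
  "bdd_above {cmod (f z) | f. f holomorphic_on UNIV \<and> (\<forall>w. cmod (f w) \<le> \<omega> (cmod w))}"
  by (rule bdd_aboveI[of _ "\<omega> (cmod z)"]) auto

lemma le_associated_weight:
  assumes "f holomorphic_on UNIV" "\<And>w. cmod (f w) \<le> \<omega> (cmod w)"
  shows "cmod (f z) \<le> associated_weight \<omega> (cmod z)"
  unfolding associated_weight_cmod
  by (rule cSup_upper[OF _ associated_weight_bdd]) (use assms in auto)

lemma zero_test_function:
  assumes "weight_function \<omega>"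
  shows "(\<lambda>z. 0 :: complex) holomorphic_on UNIV" "cmod 0 \<le> \<omega> (cmod w)"
  using assms by (auto simp: weight_function_def less_imp_le)

lemma associated_weight_nonempty:
  assumes "weight_function \<omega>"
  shows "{cmod (f z) | f. f holomorphic_on UNIV \<and> (\<forall>w. cmod (f w) \<le> \<omega> (cmod w))} \<noteq> {}"
  using zero_test_function[OF assms] by (auto intro!: exI[of _ "\<lambda>_. 0"])

lemma associated_weight_leI:
  assumes "weight_function \<omega>"
    and "\<And>f. f holomorphic_on UNIV \<Longrightarrow> (\<And>w. cmod (f w) \<le> \<omega> (cmod w)) \<Longrightarrow> cmod (f z) \<le> B"
  shows "associated_weight \<omega> (cmod z) \<le> B"
  unfolding associated_weight_cmod
  by (rule cSup_least[OF associated_weight_nonempty[OF assms(1)]]) (use assms in auto)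

lemma associated_weight_nonneg:
  assumes "weight_function \<omega>"
  shows "0 \<le> associated_weight \<omega> (cmod z)"
  using le_associated_weight[of "\<lambda>_. 0" \<omega> z] zero_test_function[OF assms] by simp

lemma le_mult_associated_weight:
  assumes \<omega>: "weight_function \<omega>" and f: "f holomorphic_on UNIV"
    and le: "\<And>w. cmod (f w) \<le> B * \<omega> (cmod w)"
  shows "cmod (f z) \<le> B * associated_weight \<omega> (cmod z)"
proof -
  have w0: "0 < \<omega> 0" using \<omega> by (simp add: weight_function_def)
  have "0 \<le> B * \<omega> 0" using le[of 0] norm_ge_zero[of "f 0"] by (simp del: norm_ge_zero)
  then have "0 \<le> B" using w0 by (simp add: zero_le_mult_iff)
  show ?thesis
  proof (cases "B = 0")
    case True
    then show ?thesis using le[of z] by simp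
  next
    case False
    then have B: "0 < B" using \<open>0 \<le> B\<close> by simp
    have "cmod (f z / of_real B) \<le> associated_weight \<omega> (cmod z)"
      by (rule le_associated_weight[of "\<lambda>z. f z / of_real B"])
        (use B f le in \<open>auto intro!: holomorphic_intros simp: norm_divide pos_divide_le_eq mult.commute\<close>)
    then show ?thesis using B by (simp add: norm_divide pos_divide_le_eq mult.commute)
  qed
qed

text \<open>A supremum of continuous functions is lower semicontinuous: its superlevel sets are
  unions of open sets, so the uncountable family does no harm.\<close>

lemma associated_weight_measurable:
  assumes "weight_function \<omega>"
  shows "(\<lambda>z. associated_weight \<omega> (cmod z)) \<in> borel_measurable borel"
proof (subst borel_measurable_iff_greater, intro allI)
  fix c
  let ?B = "{f. f holomorphic_on UNIV \<and> (\<forall>w. cmod (f w) \<le> \<omega> (cmod w))}"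
  have "c < associated_weight \<omega> (cmod z) \<longleftrightarrow> (\<exists>f\<in>?B. c < cmod (f z))" for z
    unfolding associated_weight_cmod
    by (subst less_cSup_iff[OF associated_weight_nonempty[OF assms] associated_weight_bdd]) auto
  then have "{z. c < associated_weight \<omega> (cmod z)} = (\<Union>f\<in>?B. {z. c < cmod (f z)})" by auto
  moreover have "open (\<Union>f\<in>?B. {z. c < cmod (f z)})"
    by (intro open_UN ballI open_Collect_less continuous_intros holomorphic_on_imp_continuous_on) auto
  ultimately show "{z \<in> space borel. c < associated_weight \<omega> (cmod z)} \<in> sets borel" by simp
qed

lemma growth_spaceD:
  assumes \<omega>: "weight_function \<omega>" and f: "f \<in> growth_space \<omega>"
  shows "f holomorphic_on UNIV" "cmod (f z) \<le> growth_norm \<omega> f * \<omega> (cmod z)" "0 \<le> growth_norm \<omega> f"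
proof -
  show "f holomorphic_on UNIV" using f by (simp add: growth_space_def)
  have up: "cmod (f z) / \<omega> (cmod z) \<le> growth_norm \<omega> f" for z
    unfolding growth_norm_def using f by (intro cSUP_upper) (auto simp: growth_space_def)
  have pos: "0 < \<omega> (cmod z)" for z using \<omega> by (simp add: weight_function_def)
  show "cmod (f z) \<le> growth_norm \<omega> f * \<omega> (cmod z)"
    using up[of z] pos[of z] by (simp add: pos_divide_le_eq)
  show "0 \<le> growth_norm \<omega> f"
    using pos[of 0] by (intro order_trans[OF _ up[of 0]]) auto
qed

lemma growth_spaceI:
  assumes "weight_function \<omega>" "f holomorphic_on UNIV" "\<And>z. cmod (f z) \<le> B * \<omega> (cmod z)"
  shows "f \<in> growth_space \<omega>"
proof -
  have "cmod (f z) / \<omega> (cmod z) \<le> B" for z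
    using assms(1) assms(3)[of z] by (simp add: weight_function_def pos_divide_le_eq)
  then have "bdd_above (range (\<lambda>z. cmod (f z) / \<omega> (cmod z)))" by (intro bdd_aboveI2)
  then show ?thesis using assms(2) by (simp add: growth_space_def)
qed

section \<open>The operator, its derivative and its value at the origin\<close>

lemma contour_integrable_linepath_holomorphic:
  assumes "f holomorphic_on UNIV"
  shows "f contour_integrable_on linepath a b"
  using assms holomorphic_on_imp_continuous_on continuous_on_subset
  by (intro contour_integrable_continuous_linepath) blast

lemma volterra_has_field_derivative:
  assumes "f holomorphic_on UNIV" "g holomorphic_on UNIV"
  shows "(volterra g f has_field_derivative f z * deriv g z) (at z)"
proof -
  let ?h = "\<lambda>\<xi>. f \<xi> * deriv g \<xi>"
  have h: "?h holomorphic_on UNIV" using assms by (intro holomorphic_intros) auto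
  have "((\<lambda>x. contour_integral (linepath 0 x) ?h) has_field_derivative ?h z) (at z)"
  proof (rule triangle_contour_integrals_starlike_primitive[where S = UNIV])
    show "continuous_on UNIV ?h" using h by (rule holomorphic_on_imp_continuous_on)
    fix b c :: complex
    have "(?h has_contour_integral 0) (linepath 0 b +++ linepath b c +++ linepath c 0)"
      using h by (intro Cauchy_theorem_triangle holomorphic_on_subset[OF h]) auto
    then show "contour_integral (linepath 0 b) ?h + contour_integral (linepath b c) ?h +
        contour_integral (linepath c 0) ?h = 0"
      by (rule has_chain_integral_chain_integral3)
  qed auto
  then show ?thesis by (simp add: volterra_def[abs_def])
qed

lemma comp_volterra_eq: "comp_volterra \<phi> g f z = volterra g f (\<phi> z)"
  by (simp add: comp_volterra_def composition_op_def)

lemma comp_volterra_has_field_derivative: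
  assumes "f holomorphic_on UNIV" "g holomorphic_on UNIV" "\<phi> holomorphic_on UNIV"
  shows "(comp_volterra \<phi> g f has_field_derivative f (\<phi> z) * (deriv g (\<phi> z) * deriv \<phi> z)) (at z)"
proof -
  have "(\<phi> has_field_derivative deriv \<phi> z) (at z)"
    using assms(3) by (meson UNIV_I holomorphic_derivI open_UNIV)
  from DERIV_chain2[OF volterra_has_field_derivative[OF assms(1,2)] this]
  show ?thesis by (simp add: comp_volterra_eq[abs_def] mult.assoc)
qed

lemma comp_volterra_holomorphic:
  assumes "f holomorphic_on UNIV" "g holomorphic_on UNIV" "\<phi> holomorphic_on UNIV"
  shows "comp_volterra \<phi> g f holomorphic_on UNIV"
  using comp_volterra_has_field_derivative[OF assms] by (auto simp: holomorphic_on_open)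

lemma cmod_deriv_comp_volterra:
  assumes "f holomorphic_on UNIV" "g holomorphic_on UNIV" "\<phi> holomorphic_on UNIV"
  shows "cmod (deriv (comp_volterra \<phi> g f) z) = cmod (f (\<phi> z)) * cmod (deriv g (\<phi> z) * deriv \<phi> z)"
  using DERIV_imp_deriv[OF comp_volterra_has_field_derivative[OF assms]] by (simp add: norm_mult)

lemma comp_volterra_linear:
  assumes "f holomorphic_on UNIV" "h holomorphic_on UNIV" "g holomorphic_on UNIV"
  shows "comp_volterra \<phi> g (\<lambda>z. f z + h z) = (\<lambda>z. comp_volterra \<phi> g f z + comp_volterra \<phi> g h z)"
    and "comp_volterra \<phi> g (\<lambda>z. c * f z) = (\<lambda>z. c * comp_volterra \<phi> g f z)"
proof -
  have int: "(\<lambda>\<xi>. u \<xi> * deriv g \<xi>) contour_integrable_on linepath 0 z" if "u holomorphic_on UNIV" for u z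
    using that assms by (intro contour_integrable_linepath_holomorphic holomorphic_intros) auto
  show "comp_volterra \<phi> g (\<lambda>z. f z + h z) = (\<lambda>z. comp_volterra \<phi> g f z + comp_volterra \<phi> g h z)"
    using assms by (simp add: comp_volterra_eq[abs_def] volterra_def distrib_right contour_integral_add int)
  show "comp_volterra \<phi> g (\<lambda>z. c * f z) = (\<lambda>z. c * comp_volterra \<phi> g f z)"
    using assms by (simp add: comp_volterra_eq[abs_def] volterra_def mult.assoc contour_integral_lmul int)
qed

text \<open>Passing to the derivative loses the constant term, which need not vanish: the value at 0
  is an integral along the segment from 0 to \<open>\<phi> 0\<close>. On this segment
  \<open>f\<close> is bounded through the weight and \<open>deriv g\<close> by compactness.\<close>

lemma comp_volterra_at_0_le:
  assumes \<omega>: "weight_function \<omega>" and g: "g holomorphic_on UNIV"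
  obtains c where "0 \<le> c" "\<And>f B. f holomorphic_on UNIV \<Longrightarrow> (\<And>w. cmod (f w) \<le> B * \<omega> (cmod w)) \<Longrightarrow>
    0 \<le> B \<Longrightarrow> cmod (comp_volterra \<phi> g f 0) \<le> c * B"
proof -
  have dg: "deriv g holomorphic_on UNIV" using g by (simp add: holomorphic_deriv)
  obtain w where w: "\<And>v. cmod v \<le> cmod (\<phi> 0) \<Longrightarrow> cmod (deriv g v) \<le> cmod (deriv g w)"
    using cmod_attains_max_cball[OF holomorphic_on_imp_continuous_on[OF dg], of "cmod (\<phi> 0)" 0] by auto
  have pos: "0 < \<omega> (cmod z)" for z using \<omega> by (simp add: weight_function_def)
  define c where "c = \<omega> (cmod (\<phi> 0)) * cmod (deriv g w) * cmod (\<phi> 0)"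
  have "cmod (comp_volterra \<phi> g f 0) \<le> c * B"
    if f: "f holomorphic_on UNIV" and le: "\<And>w. cmod (f w) \<le> B * \<omega> (cmod w)" and B: "0 \<le> B" for f B
  proof -
    have "cmod (contour_integral (linepath 0 (\<phi> 0)) (\<lambda>\<xi>. f \<xi> * deriv g \<xi>))
        \<le> (B * \<omega> (cmod (\<phi> 0)) * cmod (deriv g w)) * cmod (\<phi> 0 - 0)"
    proof (rule contour_integral_bound_linepath)
      show "(\<lambda>\<xi>. f \<xi> * deriv g \<xi>) contour_integrable_on linepath 0 (\<phi> 0)"
        by (intro contour_integrable_linepath_holomorphic holomorphic_on_mult f dg)
      show "0 \<le> B * \<omega> (cmod (\<phi> 0)) * cmod (deriv g w)" using B pos[of "\<phi> 0"] by simp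
      fix x assume "x \<in> closed_segment 0 (\<phi> 0)"
      then have x: "cmod x \<le> cmod (\<phi> 0)" using segment_bound1[of x 0 "\<phi> 0"] by simp
      have "cmod (f x) \<le> B * \<omega> (cmod x)" by (rule le)
      also have "\<dots> \<le> B * \<omega> (cmod (\<phi> 0))"
        using B x \<omega> by (intro mult_left_mono) (auto simp: weight_function_def mono_on_def)
      finally show "cmod (f x * deriv g x) \<le> B * \<omega> (cmod (\<phi> 0)) * cmod (deriv g w)"
        using w[OF x] B pos[of "\<phi> 0"] by (auto simp: norm_mult intro!: mult_mono)
    qed
    then show ?thesis by (simp add: comp_volterra_eq volterra_def c_def mult_ac)
  qed
  moreover have "0 \<le> c" using pos[of "\<phi> 0"] by (simp add: c_def)
  ultimately show ?thesis using that by blast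
qed

lemma integrable_lebesgue_iff_nn_integral:
  fixes h :: "complex \<Rightarrow> real"
  assumes "h \<in> borel_measurable borel" "\<And>x. 0 \<le> h x"
  shows "integrable lebesgue h \<longleftrightarrow> (\<integral>\<^sup>+x. ennreal (h x) \<partial>lborel) < \<infinity>"
proof -
  have "h \<in> borel_measurable lebesgue" using assms(1) by (simp add: measurable_completion)
  then show ?thesis using assms(2) by (simp add: integrable_iff_bounded nn_integral_completion)
qed

lemma powr_gaussian:
  fixes x y :: real
  assumes "0 \<le> x" "0 \<le> y"
  shows "(x / y * exp (- (\<alpha> / 2) * t)) powr q = (x / y) powr q * exp (- (\<alpha> * q / 2) * t)"
proof -
  have "exp (- (\<alpha> / 2) * t) powr q = exp (- (\<alpha> * q / 2) * t)" by (simp add: powr_def)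
  then show ?thesis by (simp only: powr_mult)
qed

lemma sum3_powr_le:
  fixes x :: "nat \<Rightarrow> real"
  assumes x: "\<And>p. 0 \<le> x p" and q: "0 < q"
  shows "(\<Sum>p<3. x p) powr q \<le> 3 powr q * (\<Sum>p<3. x p powr q)"
proof -
  have "Max (x ` {..<3}) \<in> x ` {..<3}" by (intro Max_in) (auto simp: lessThan_empty_iff)
  then obtain p where p: "p < 3" "Max (x ` {..<3}) = x p" by auto
  have p_max: "x p' \<le> x p" if "p' < 3" for p'
    unfolding p(2)[symmetric] using that by (intro Max_ge) auto
  have "(\<Sum>p'<3. x p') \<le> (\<Sum>p'<(3::nat). x p)" by (intro sum_mono p_max) simp
  then have "(\<Sum>p'<3. x p') powr q \<le> (3 * x p) powr q"
    using q x by (intro powr_mono2 sum_nonneg) auto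
  also have "\<dots> = 3 powr q * x p powr q" using x by (simp add: powr_mult)
  also have "\<dots> \<le> 3 powr q * (\<Sum>p<3. x p powr q)"
    using p by (intro mult_left_mono member_le_sum) auto
  finally show ?thesis .
qed

text \<open>Bridges the essential supremum of (ii) for \<open>q = \<infinity>\<close> and the true
  supremum in the Fock norm: a continuous function that exceeds \<open>K\<close> at one point does
  so on a disc of positive measure.\<close>

lemma AE_lebesgue_continuous_le:
  fixes h :: "complex \<Rightarrow> real"
  assumes h: "continuous_on UNIV h" and AE: "AE z in lebesgue. h z \<le> K"
  shows "h z \<le> K"
proof (rule ccontr)
  let ?U = "{z. \<not> h z \<le> K}"
  assume "\<not> h z \<le> K"
  moreover have op: "open ?U"
    unfolding not_le by (intro open_Collect_less continuous_intros h)
  ultimately obtain e where e: "0 < e" "ball z e \<subseteq> ?U" by (auto simp: open_contains_ball)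
  have "AE z in lborel. h z \<le> K" using AE by (simp add: AE_completion_iff)
  then have "?U \<in> null_sets lborel" using op AE_iff_null[of lborel "\<lambda>z. h z \<le> K"] by simp
  then have "ball z e \<in> null_sets lborel"
    using e by (elim null_sets_subset) auto
  then have "emeasure lborel (ball z e) = 0" by (rule null_setsD1)
  then show False using e by (simp add: emeasure_lborel_ball_complex)
qed

section \<open>The equivalence\<close>

theorem corollary1p4:
  fixes \<omega> :: "real \<Rightarrow> real" and \<phi> g :: "complex \<Rightarrow> complex" and \<alpha> :: real and q :: ereal
  assumes "weight_function \<omega>"
    and "\<phi> holomorphic_on UNIV" and "g holomorphic_on UNIV"
    and "\<alpha> > 0" and "0 < q"
  shows "bounded_operator (growth_space \<omega>) (growth_norm \<omega>)
           (fock_space \<alpha> q) (fock_norm \<alpha> q) (comp_volterra \<phi> g)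
         \<longleftrightarrow>
         (\<lambda>z. cmod (deriv g (\<phi> z) * deriv \<phi> z) / (1 + cmod z) *
              exp (- (\<alpha> / 2) * (cmod z)\<^sup>2) * associated_weight \<omega> (cmod (\<phi> z)))
           \<in> Lq q lebesgue"
proof -
  note \<omega> = assms(1) and \<phi> = assms(2) and g = assms(3) and \<alpha> = assms(4) and q = assms(5)
  define G where "G = (\<lambda>z. cmod (deriv g (\<phi> z) * deriv \<phi> z) / (1 + cmod z) * exp (- (\<alpha> / 2) * (cmod z)\<^sup>2))"
  define h where "h = (\<lambda>z. G z * associated_weight \<omega> (cmod (\<phi> z)))"
  let ?T = "comp_volterra \<phi> g"
  have one: "1 + cmod z \<noteq> 0" for z using norm_ge_zero[of z] by linarith
  have G0: "0 \<le> G z" for z by (simp add: G_def)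
  have h0: "0 \<le> h z" for z using G0 associated_weight_nonneg[OF \<omega>] by (simp add: h_def)
  have ent: "continuous_on UNIV F" "F \<in> borel_measurable borel" if "F holomorphic_on UNIV" for F :: "complex \<Rightarrow> complex"
    using that by (auto intro: holomorphic_on_imp_continuous_on borel_measurable_continuous_onI)
  note dent = ent[OF holomorphic_deriv[OF _ open_UNIV]]
  note [measurable] = ent(2)[OF \<phi>] dent(2)[OF \<phi>] dent(2)[OF g]
  have [measurable]: "G \<in> borel_measurable borel" unfolding G_def by measurable
  have [measurable]: "(\<lambda>z. associated_weight \<omega> (cmod (\<phi> z))) \<in> borel_measurable borel"
    using measurable_compose[OF ent(2)[OF \<phi>] associated_weight_measurable[OF \<omega>]] .
  have [measurable]: "h \<in> borel_measurable borel" unfolding h_def by measurable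
  have T: "?T f holomorphic_on UNIV"
    and D: "cmod (deriv (?T f) z) / (1 + cmod z) * exp (- (\<alpha> / 2) * (cmod z)\<^sup>2) = cmod (f (\<phi> z)) * G z"
    if "f holomorphic_on UNIV" for f z
    using comp_volterra_holomorphic[OF that g \<phi>] cmod_deriv_comp_volterra[OF that g \<phi>]
    by (simp_all add: G_def)
  note X = growth_spaceD[OF \<omega>]
  obtain c where c: "0 \<le> c" "\<And>f B. f holomorphic_on UNIV \<Longrightarrow> (\<And>w. cmod (f w) \<le> B * \<omega> (cmod w)) \<Longrightarrow>
      0 \<le> B \<Longrightarrow> cmod (?T f 0) \<le> c * B"
    by (rule comp_volterra_at_0_le[OF \<omega> g, of \<phi>]) blast
  have T0: "cmod (?T f 0) \<le> c * growth_norm \<omega> f" if "f \<in> growth_space \<omega>" for f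
    using X[OF that] by (intro c(2)) auto
  \<comment> \<open>This bound and \<open>h_F\<close> below carry all information about the weight:
    the first controls every derivative by \<open>h\<close>, the second controls \<open>h\<close> by
    the derivatives of three images.\<close>
  have f_h: "cmod (f (\<phi> z)) * G z \<le> growth_norm \<omega> f * h z" if "f \<in> growth_space \<omega>" for f z
    using mult_right_mono[OF le_mult_associated_weight[OF \<omega> X(1,2)[OF that], where z = "\<phi> z"] G0[of z]]
    by (simp add: h_def mult_ac)
  obtain F :: "nat \<Rightarrow> complex \<Rightarrow> complex" where F: "\<And>p. F p holomorphic_on UNIV"
    "\<And>p z. cmod (F p z) \<le> 8 * \<omega> (cmod z)"
    "\<And>f z. f holomorphic_on UNIV \<Longrightarrow> (\<And>w. cmod (f w) \<le> \<omega> (cmod w)) \<Longrightarrow>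
       cmod (f z) \<le> 40 * (\<Sum>p<3. cmod (F p z))"
    by (rule weight_function_test_functions[OF \<omega>]) blast
  have FX: "F p \<in> growth_space \<omega>" for p by (rule growth_spaceI[OF \<omega> F(1,2)])
  have h_F: "h z \<le> 40 * (\<Sum>p<3. cmod (F p (\<phi> z)) * G z)" for z
  proof -
    have "associated_weight \<omega> (cmod (\<phi> z)) \<le> 40 * (\<Sum>p<3. cmod (F p (\<phi> z)))"
      by (rule associated_weight_leI[OF \<omega> F(3)])
    from mult_left_mono[OF this G0[of z]] show ?thesis
      by (simp add: h_def sum_distrib_left sum_distrib_right mult_ac)
  qed
  have lin: "\<forall>f\<in>growth_space \<omega>. \<forall>h\<in>growth_space \<omega>. ?T (\<lambda>z. f z + h z) = (\<lambda>z. ?T f z + ?T h z)"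
    "\<forall>c. \<forall>f\<in>growth_space \<omega>. ?T (\<lambda>z. c * f z) = (\<lambda>z. c * ?T f z)"
    using comp_volterra_linear[OF X(1) X(1) g] by blast+
  have "bounded_operator (growth_space \<omega>) (growth_norm \<omega>) (fock_space \<alpha> q) (fock_norm \<alpha> q) ?T
      \<longleftrightarrow> h \<in> Lq q lebesgue" (is "?L \<longleftrightarrow> ?R")
  proof (cases "q = \<infinity>")
    case True
    show ?thesis
    proof
      assume ?L
      have "\<exists>B. \<forall>z. cmod (F p (\<phi> z)) * G z \<le> B" for p
      proof -
        have "?T (F p) \<in> fock_space \<alpha> q" using \<open>?L\<close> FX by (simp add: bounded_operator_def)
        then obtain B where "\<And>z. cmod (?T (F p) z) * exp (- (\<alpha> / 2) * (cmod z)\<^sup>2) \<le> B"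
          using True by (auto simp: fock_space_def bdd_above_def)
        from deriv_growth_of_growth[OF T[OF F(1)] _ this] show ?thesis
          unfolding D[OF F(1)] using \<alpha> by auto
      qed
      then obtain B where B: "\<And>p z. cmod (F p (\<phi> z)) * G z \<le> B p" by metis
      have "\<bar>h z\<bar> \<le> 40 * (\<Sum>p<3. B p)" for z
        using h0[of z] h_F[of z] sum_mono[of "{..<3}" "\<lambda>p. cmod (F p (\<phi> z)) * G z" B] B by simp
      then show ?R using True by (auto simp: Lq_def measurable_completion)
    next
      assume ?R
      then obtain K where K: "AE z in lebesgue. \<bar>h z\<bar> \<le> K" using True by (auto simp: Lq_def)
      \<comment> \<open>Truncation at 0 supplies the nonnegative bound that the estimate along rays
        asks for.\<close>
      define K' where "K' = max K 0"
      define C where "C = c + K' * (1 / (\<alpha> / 2) + 2 * exp (\<alpha> / 2) * (1 + 1 / (\<alpha> / 2)))"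
      have bd: "cmod (?T f z) * exp (- (\<alpha> / 2) * (cmod z)\<^sup>2) \<le> C * growth_norm \<omega> f"
        if f: "f \<in> growth_space \<omega>" for f z
      proof -
        note f' = X[OF f]
        have "cmod (deriv (?T f) z) / (1 + cmod z) * exp (- (\<alpha> / 2) * (cmod z)\<^sup>2) \<le> growth_norm \<omega> f * K'" for z
        proof (rule AE_lebesgue_continuous_le)
          show "continuous_on UNIV (\<lambda>z. cmod (deriv (?T f) z) / (1 + cmod z) * exp (- (\<alpha> / 2) * (cmod z)\<^sup>2))"
            using one by (intro continuous_intros dent T f') auto
          show "AE z in lebesgue. cmod (deriv (?T f) z) / (1 + cmod z) * exp (- (\<alpha> / 2) * (cmod z)\<^sup>2)
              \<le> growth_norm \<omega> f * K'"
            using K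
          proof eventually_elim
            case (elim z)
            then have "h z \<le> K'" by (simp add: K'_def)
            then have "growth_norm \<omega> f * h z \<le> growth_norm \<omega> f * K'" using f' by (intro mult_left_mono)
            then show ?case unfolding D[OF f'(1)] using f_h[OF f, of z] by linarith
          qed
        qed
        from growth_of_deriv_growth[OF T[OF f'(1)] _ _ this]
        have "cmod (?T f z) * exp (- (\<alpha> / 2) * (cmod z)\<^sup>2) \<le> cmod (?T f 0) +
            growth_norm \<omega> f * K' * (1 / (\<alpha> / 2) + 2 * exp (\<alpha> / 2) * (1 + 1 / (\<alpha> / 2)))"
          using \<alpha> f' by (auto simp: K'_def)
        also have "\<dots> \<le> c * growth_norm \<omega> f +
            growth_norm \<omega> f * K' * (1 / (\<alpha> / 2) + 2 * exp (\<alpha> / 2) * (1 + 1 / (\<alpha> / 2)))"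
          using T0[OF f] by simp
        also have "\<dots> = C * growth_norm \<omega> f" by (simp add: C_def algebra_simps)
        finally show ?thesis .
      qed
      have mem: "?T f \<in> fock_space \<alpha> q" if f: "f \<in> growth_space \<omega>" for f
        using T[OF X(1)[OF f]] True bdd_aboveI2[of UNIV, OF bd[OF f]] by (simp add: fock_space_def)
      have nrm: "fock_norm \<alpha> q (?T f) \<le> C * growth_norm \<omega> f" if f: "f \<in> growth_space \<omega>" for f
        unfolding fock_norm_def using True bd[OF f] by (auto intro: cSUP_least)
      show ?L unfolding bounded_operator_def using mem nrm lin by blast
    qed
  next
    case False
    then obtain r where r: "q = ereal r" "0 < r" using q by (cases q) auto
    define a where "a = \<alpha> * r / 2"
    have a: "0 < a" using \<alpha> r by (simp add: a_def)
    have D': "(cmod (deriv (?T f) z) / (1 + cmod z)) powr r * exp (- a * (cmod z)\<^sup>2) = (cmod (f (\<phi> z)) * G z) powr r"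
      if "f holomorphic_on UNIV" for f z
      unfolding D[OF that, symmetric] a_def
      by (rule powr_gaussian[symmetric]) (simp_all add: add_nonneg_nonneg)
    have fock: "u \<in> fock_space \<alpha> q \<longleftrightarrow> (\<integral>\<^sup>+z. ennreal (cmod (u z) powr r * exp (- a * (cmod z)\<^sup>2)) \<partial>lborel) < \<infinity>"
      if u: "u holomorphic_on UNIV" for u
    proof -
      note [measurable] = ent(2)[OF u]
      show ?thesis using u r integrable_lebesgue_iff_nn_integral[of "\<lambda>z. cmod (u z) powr r * exp (- a * (cmod z)\<^sup>2)"]
        by (simp add: fock_space_def a_def)
    qed
    have Lq: "?R \<longleftrightarrow> (\<integral>\<^sup>+z. ennreal (h z powr r) \<partial>lborel) < \<infinity>"
    proof -
      have "?R \<longleftrightarrow> integrable lebesgue (\<lambda>z. h z powr r)"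
        using r h0 by (simp add: Lq_def measurable_completion)
      then show ?thesis by (subst (asm) integrable_lebesgue_iff_nn_integral) auto
    qed
    show ?thesis
    proof
      assume ?L
      have fin: "(\<integral>\<^sup>+z. ennreal ((cmod (F p (\<phi> z)) * G z) powr r) \<partial>lborel) < \<infinity>" for p
      proof -
        obtain C where C: "\<And>u. u holomorphic_on UNIV \<Longrightarrow>
           (\<integral>\<^sup>+z. ennreal ((cmod (deriv u z) / (1 + cmod z)) powr r * exp (- a * (cmod z)\<^sup>2)) \<partial>lborel)
           \<le> ennreal C * (\<integral>\<^sup>+z. ennreal (cmod (u z) powr r * exp (- a * (cmod z)\<^sup>2)) \<partial>lborel)"
          by (rule nn_integral_deriv_le[OF r(2) a]) blast
        have "?T (F p) \<in> fock_space \<alpha> q" using \<open>?L\<close> FX by (simp add: bounded_operator_def)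
        then have "ennreal C * (\<integral>\<^sup>+z. ennreal (cmod (?T (F p) z) powr r * exp (- a * (cmod z)\<^sup>2)) \<partial>lborel) < \<infinity>"
          unfolding fock[OF T[OF F(1)]] by (simp add: ennreal_mult_less_top)
        from le_less_trans[OF C[OF T[OF F(1)]] this] show ?thesis by (simp only: D'[OF F(1)])
      qed
      \<comment> \<open>Here \<open>120 = 40 * 3\<close>: the constant of the test functions, and
        the price of distributing the power over three summands for any positive
        \<open>r\<close>.\<close>
      have "ennreal (h z powr r) \<le> ennreal (120 powr r) * (\<Sum>p<3. ennreal ((cmod (F p (\<phi> z)) * G z) powr r))" for z
      proof -
        have "h z powr r \<le> (40 * (\<Sum>p<3. cmod (F p (\<phi> z)) * G z)) powr r"
          using h_F h0 r by (intro powr_mono2) auto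
        also have "\<dots> = 40 powr r * (\<Sum>p<3. cmod (F p (\<phi> z)) * G z) powr r"
          using G0 by (intro powr_mult)
        also have "\<dots> \<le> 40 powr r * (3 powr r * (\<Sum>p<3. (cmod (F p (\<phi> z)) * G z) powr r))"
          using G0 r by (intro mult_left_mono sum3_powr_le) auto
        also have "\<dots> = 120 powr r * (\<Sum>p<3. (cmod (F p (\<phi> z)) * G z) powr r)"
          by (simp flip: powr_mult mult.assoc)
        finally show ?thesis
          by (simp add: sum_nonneg sum_ennreal flip: ennreal_mult)
      qed
      then have "(\<integral>\<^sup>+z. ennreal (h z powr r) \<partial>lborel)
          \<le> (\<integral>\<^sup>+z. ennreal (120 powr r) * (\<Sum>p<3. ennreal ((cmod (F p (\<phi> z)) * G z) powr r)) \<partial>lborel)"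
        by (intro nn_integral_mono)
      also have "\<dots> = ennreal (120 powr r) * (\<Sum>p<3. \<integral>\<^sup>+z. ennreal ((cmod (F p (\<phi> z)) * G z) powr r) \<partial>lborel)"
      proof -
        note [measurable] = ent(2)[OF F(1)]
        show ?thesis by (simp add: nn_integral_cmult nn_integral_sum del: sum_ennreal)
      qed
      also have "\<dots> < \<infinity>" using fin by (simp add: ennreal_mult_less_top)
      finally show ?R by (simp only: Lq)
    next
      assume ?R
      define H where "H = enn2real (\<integral>\<^sup>+z. ennreal (h z powr r) \<partial>lborel)"
      have H: "(\<integral>\<^sup>+z. ennreal (h z powr r) \<partial>lborel) = ennreal H"
        using \<open>?R\<close> unfolding Lq by (simp add: H_def)
      have H0: "0 \<le> H" by (simp add: H_def)
      obtain C where C: "0 < C" "\<And>u. u holomorphic_on UNIV \<Longrightarrow>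
          (\<integral>\<^sup>+z. ennreal (cmod (u z) powr r * exp (- a * (cmod z)\<^sup>2)) \<partial>lborel)
          \<le> ennreal C * (ennreal (cmod (u 0) powr r) +
             (\<integral>\<^sup>+z. ennreal ((cmod (deriv u z) / (1 + cmod z)) powr r * exp (- a * (cmod z)\<^sup>2)) \<partial>lborel))"
        by (rule nn_integral_le_deriv[OF r(2) a]) blast
      define K where "K = C * (c powr r + H)"
      have K0: "0 \<le> K" using C H0 by (simp add: K_def)
      have bd: "(\<integral>\<^sup>+z. ennreal (cmod (?T f z) powr r * exp (- a * (cmod z)\<^sup>2)) \<partial>lborel)
          \<le> ennreal (K * growth_norm \<omega> f powr r)" if f: "f \<in> growth_space \<omega>" for f
      proof -
        note f' = X[OF f]
        have "(\<integral>\<^sup>+z. ennreal ((cmod (f (\<phi> z)) * G z) powr r) \<partial>lborel)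
            \<le> (\<integral>\<^sup>+z. ennreal (growth_norm \<omega> f powr r) * ennreal (h z powr r) \<partial>lborel)"
        proof (intro nn_integral_mono)
          fix z
          have "(cmod (f (\<phi> z)) * G z) powr r \<le> (growth_norm \<omega> f * h z) powr r"
            using f_h[OF f] r G0 by (intro powr_mono2) auto
          then show "ennreal ((cmod (f (\<phi> z)) * G z) powr r) \<le> ennreal (growth_norm \<omega> f powr r) * ennreal (h z powr r)"
            using f' h0 by (simp add: powr_mult ennreal_leI flip: ennreal_mult)
        qed
        also have "\<dots> = ennreal (growth_norm \<omega> f powr r * H)"
          using H0 by (simp add: nn_integral_cmult H ennreal_mult)
        finally have d: "(\<integral>\<^sup>+z. ennreal ((cmod (f (\<phi> z)) * G z) powr r) \<partial>lborel) \<le> ennreal (growth_norm \<omega> f powr r * H)" .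
        have "cmod (?T f 0) powr r \<le> (c * growth_norm \<omega> f) powr r" using T0[OF f] r by (intro powr_mono2) auto
        then have t: "ennreal (cmod (?T f 0) powr r) \<le> ennreal (c powr r * growth_norm \<omega> f powr r)"
          using c f' by (simp add: powr_mult ennreal_leI)
        have "(\<integral>\<^sup>+z. ennreal (cmod (?T f z) powr r * exp (- a * (cmod z)\<^sup>2)) \<partial>lborel)
           \<le> ennreal C * (ennreal (cmod (?T f 0) powr r) + (\<integral>\<^sup>+z. ennreal ((cmod (f (\<phi> z)) * G z) powr r) \<partial>lborel))"
          using C(2)[OF T[OF f'(1)]] by (simp only: D'[OF f'(1)])
        also have "\<dots> \<le> ennreal C * (ennreal (c powr r * growth_norm \<omega> f powr r) + ennreal (growth_norm \<omega> f powr r * H))"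
          using t d by (intro mult_left_mono add_mono) auto
        also have "\<dots> = ennreal (K * growth_norm \<omega> f powr r)"
          using C(1) H0 by (simp add: K_def algebra_simps flip: ennreal_plus ennreal_mult)
        finally show ?thesis .
      qed
      have mem: "?T f \<in> fock_space \<alpha> q" if f: "f \<in> growth_space \<omega>" for f
        using le_less_trans[OF bd[OF f] ennreal_less_top] fock[OF T[OF X(1)[OF f]]] by simp
      have nrm: "fock_norm \<alpha> q (?T f) \<le> (\<alpha> * r / (2 * pi) * K) powr (1 / r) * growth_norm \<omega> f"
        if f: "f \<in> growth_space \<omega>" for f
      proof -
        let ?u = "\<lambda>z. cmod (?T f z) powr r * exp (- a * (cmod z)\<^sup>2)"
        have int: "integrable lebesgue ?u" using mem[OF f] r by (simp add: fock_space_def a_def)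
        have "ennreal (LINT z|lebesgue. ?u z) = (\<integral>\<^sup>+z. ennreal (?u z) \<partial>lborel)"
          using nn_integral_eq_integral[OF int] by (simp add: nn_integral_completion)
        then have "ennreal (LINT z|lebesgue. ?u z) \<le> ennreal (K * growth_norm \<omega> f powr r)"
          using bd[OF f] by (simp only:)
        then have "(LINT z|lebesgue. ?u z) \<le> K * growth_norm \<omega> f powr r"
          using K0 by (subst (asm) ennreal_le_iff) auto
        then have "\<alpha> * r / (2 * pi) * (LINT z|lebesgue. ?u z) \<le> \<alpha> * r / (2 * pi) * (K * growth_norm \<omega> f powr r)"
          using \<alpha> r by (intro mult_left_mono) auto
        then have "(\<alpha> * r / (2 * pi) * (LINT z|lebesgue. ?u z)) powr (1 / r)
            \<le> (\<alpha> * r / (2 * pi) * (K * growth_norm \<omega> f powr r)) powr (1 / r)"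
          using \<alpha> r by (intro powr_mono2) auto
        also have "\<dots> = (\<alpha> * r / (2 * pi) * K) powr (1 / r) * (growth_norm \<omega> f powr r) powr (1 / r)"
          using \<alpha> r K0 by (subst powr_mult[symmetric]) (auto simp: mult.assoc)
        also have "(growth_norm \<omega> f powr r) powr (1 / r) = growth_norm \<omega> f"
          using r X(3)[OF f] by (simp add: powr_powr)
        finally show ?thesis using r by (simp add: fock_norm_def a_def)
      qed
      show ?L unfolding bounded_operator_def using mem nrm lin by blast
    qed
  qed
  then show ?thesis by (simp only: h_def G_def)
qed

end
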